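(* Let $K=\mathrm{SU}(2)$ and let $\mathbf{SG}_2\subset K^2$ be the set of pairs having spectral gap. Then $\mathbf{SG}_2$ has either measure zero or full measure with respect to the Haar measure on $K^2$.
   Context: $K=\mathrm{SU}(2)$ with its normalized Haar measure. $\lambda$ denotes the left regular representation of $K$ on $L^2(K)$, $(\lambda(g)f)(h)=f(g^{-1}h)$, and $L^2_0(K)$ is the subspace of functions orthogonal to the constants. An $n$-tuple $(g_1,\dots,g_n)\in K^n$ is said to have spectral gap if there exists $\varepsilon>0$ such that for every $v\in L^2_0(K)$ there is some $k\in\{1,\dots,n\}$ with $\|\lambda(g_k)v-v\|\ge\varepsilon\|v\|$. $\mathbf{SG}_n\subset K^n$ denotes the set of $n$-tuples having spectral gap. *)

theory Defs
  imports "HOL-Probability.Probability"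
begin

definition cadj :: "complex^2^2 \<Rightarrow> complex^2^2" where
  "cadj A = (\<chi> i j. cnj (A $ j $ i))"

definition SU2 :: "(complex^2^2) set" where
  "SU2 = {A. cadj A ** A = mat 1 \<and> det A = 1}"

text \<open>Haar measure on SU(2): a left-invariant Borel probability measure on SU(2)
  (unique, so quantifying over all such measures is the same as fixing it).\<close>
definition is_haar_SU2 :: "(complex^2^2) measure \<Rightarrow> bool" where
  "is_haar_SU2 M \<longleftrightarrow>
     sets M = sets (restrict_space borel SU2) \<and> prob_space M \<and>
     (\<forall>g\<in>SU2. \<forall>A\<in>sets M. emeasure M ((\<lambda>h. g ** h) -` A \<inter> SU2) = emeasure M A)"

definition L2norm :: "(complex^2^2) measure \<Rightarrow> (complex^2^2 \<Rightarrow> complex) \<Rightarrow> real" where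
  "L2norm M v = sqrt (\<integral>h. (cmod (v h))\<^sup>2 \<partial>M)"

definition L2_0 :: "(complex^2^2) measure \<Rightarrow> (complex^2^2 \<Rightarrow> complex) set" where
  "L2_0 M = {v. v \<in> borel_measurable M \<and> integrable M (\<lambda>h. (cmod (v h))\<^sup>2)
                \<and> (\<integral>h. v h \<partial>M) = 0}"

text \<open>Left regular representation: (lambda(g) v)(h) = v(g^{-1} h); on SU(2), g^{-1} = g^*.\<close>
definition lreg :: "complex^2^2 \<Rightarrow> (complex^2^2 \<Rightarrow> complex) \<Rightarrow> (complex^2^2 \<Rightarrow> complex)" where
  "lreg g v = (\<lambda>h. v (cadj g ** h))"

definition spectral_gap :: "(complex^2^2) measure \<Rightarrow> (complex^2^2) list \<Rightarrow> bool" where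
  "spectral_gap M gs \<longleftrightarrow>
     (\<exists>\<epsilon>>0. \<forall>v\<in>L2_0 M. \<exists>g\<in>set gs.
        L2norm M (\<lambda>h. lreg g v h - v h) \<ge> \<epsilon> * L2norm M v)"

end

theory Submission
  imports Defs
begin

text \<open>
  Write \<open>x = Re a\<close>, \<open>y = Re b\<close>, \<open>z = Re (a b)\<close> for half the traces of \<open>a\<close>, \<open>b\<close>, \<open>a b\<close>. The spectral gap of
  a pair \<open>(a, b)\<close> is invariant under simultaneous conjugation, so away from central \<open>a\<close> it depends only
  on \<open>(x, y, z)\<close>, and these coordinates carry Haar null sets to Lebesgue null sets. The gap is also
  unchanged under \<open>(a, b) \<mapsto> (a, a b)\<close> and \<open>(a, b) \<mapsto> (b, a)\<close>. For fixed \<open>x = cos \<alpha>\<close> the former is rotation by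
  \<open>\<alpha>\<close> on the ellipses on which \<open>D = 1 - x\<^sup>2 - y\<^sup>2 - z\<^sup>2 + 2 x y z\<close> is constant, which is ergodic for almost
  every \<open>x\<close>; hence membership is almost everywhere a function of \<open>(x, D)\<close>, by symmetry also of \<open>(y, D)\<close>,
  and therefore of \<open>D\<close> alone. This invariant \<open>D\<close> (a function of the trace of the commutator) is
  preserved by all automorphisms of the free group, but not by \<open>(a, b) \<mapsto> (a\<^sup>2, b)\<close>, which multiplies it by
  \<open>4 x\<^sup>2\<close>. A gap for \<open>(a\<^sup>2, b)\<close> implies one for \<open>(a, b)\<close>, so the set of levels \<open>D\<close> with a gap absorbs, up to
  null sets, every \<open>d\<close> for which it meets \<open>(0, 4 d (1 - d))\<close> in positive measure. This forces it to be
  null or conull in \<open>(0, 1)\<close>.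
\<close>

section \<open>Sets invariant under a dense group of translations\<close>

text \<open>A level d occurs over x only if d < 1 - x^2, and the fibres over x and y can be compared
  only at levels below (1 - x^2)(1 - y^2). No single reference fibre sees all levels, so a sequence
  of fibres tending to 0 is used instead.

  Null sets have to travel between matrices, traces and levels. Apart from Fubini, this rests on one
  fact: differentiable maps between spaces of equal dimension send null sets to null sets. No
  density of Haar measure is ever computed.

  The interval (0, 4 d (1 - d)) is the range of 4 x^2 d for 0 < x^2 < 1 - d, that is, for those x
  over which the level d occurs. Since 4 d (1 - d) \<ge> 2 d for d \<le> 1/2, positive measure
  anywhere below 1 spreads down to arbitrarily small levels, and from then on every d in (0, 1) is
  absorbed.

  Rotation by \<alpha> is ergodic when \<alpha> / (2 \<pi>) is irrational, which excludes countably
  many x. Fubini also needs the set of gap pairs to be Borel; strong continuity of the regular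
  representation makes it a countable union of relatively closed sets.\<close>

lemma additive_mono_linear:
  fixes F :: "real \<Rightarrow> real"
  assumes add: "\<And>s t. 0 \<le> s \<Longrightarrow> 0 \<le> t \<Longrightarrow> F (s + t) = F s + F t"
    and mono: "\<And>s t. 0 \<le> s \<Longrightarrow> s \<le> t \<Longrightarrow> F s \<le> F t"
    and t: "0 \<le> t"
  shows "F t = t * F 1"
proof -
  have F0: "F 0 = 0" using add[of 0 0] by simp
  have mult: "F (real n * s) = real n * F s" if "0 \<le> s" for n s
    using that by (induction n) (auto simp: F0 add algebra_simps)
  have c: "0 \<le> F 1" using mono[of 0 1] F0 by simp
  \<comment> \<open>The multiples of 1/n on either side of t trap F t between k F(1)/n and (k + 1)
    F(1)/n.\<close>
  have est: "\<bar>F t - t * F 1\<bar> \<le> F 1 / real n" if n: "n > 0" for n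
  proof -
    define k where "k = nat \<lfloor>real n * t\<rfloor>"
    have k: "real k \<le> real n * t" "real n * t \<le> real k + 1"
      using t by (auto simp: k_def)
    have u: "real n * F (real m / real n) = real m * F 1" for m
      using mult[of "real m / real n" n] mult[of 1 m] n by simp
    have "F (real k / real n) \<le> F t" "F t \<le> F (real (Suc k) / real n)"
      using k n t by (auto intro!: mono simp: field_simps)
    then have "real k * F 1 \<le> real n * F t" "real n * F t \<le> real (Suc k) * F 1"
      using u[of k] u[of "Suc k"] n by (metis mult_left_mono of_nat_0_le_iff)+
    moreover have "real k * F 1 \<le> real n * t * F 1" "real n * t * F 1 \<le> real (Suc k) * F 1"
      using k c by (auto intro!: mult_right_mono)
    ultimately have "\<bar>real n * F t - real n * t * F 1\<bar> \<le> F 1"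
      by (auto simp: algebra_simps abs_le_iff)
    also have "real n * F t - real n * t * F 1 = real n * (F t - t * F 1)"
      by (simp add: algebra_simps)
    finally have "real n * \<bar>F t - t * F 1\<bar> \<le> F 1"
      by (simp only: abs_mult abs_of_nat)
    then show ?thesis using n by (simp add: field_simps)
  qed
  have "(\<lambda>n. F 1 / real n) \<longlonglongrightarrow> 0" by (rule lim_const_over_n)
  then have "\<bar>F t - t * F 1\<bar> \<le> 0"
    by (rule Lim_bounded2[where N = 1]) (use est in auto)
  then show ?thesis by simp
qed

text \<open>Replacing an arbitrary shift by a nearby one from \<open>G\<close> changes the measure
  of \<open>A\<close> in an interval by at most the two small end pieces. Hence that measure is
  invariant under all shifts, therefore additive and monotone in the length, therefore equal to a
  constant \<open>c\<close> times the length.\<close>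

lemma dense_translation_invariant_null:
  fixes A :: "real set"
  assumes A: "A \<in> sets borel"
    and inv: "\<And>t g. g \<in> G \<Longrightarrow> t + g \<in> A \<longleftrightarrow> t \<in> A"
    and dense: "\<And>t e. 0 < e \<Longrightarrow> \<exists>g\<in>G. \<bar>g - t\<bar> < e"
  shows "A \<in> null_sets lborel \<or> - A \<in> null_sets lborel"
proof -
  note [measurable] = A
  define \<mu> where "\<mu> a b = measure lborel (A \<inter> {a..b})" for a b
  have fin: "A \<inter> {a..b} \<in> fmeasurable lborel" for a b
    by (rule fmeasurableI2[of "{a..b}"]) (auto simp: fmeasurable_def emeasure_lborel_Icc_eq)
  have split: "\<mu> a c = \<mu> a b + \<mu> b c" if "a \<le> b" "b \<le> c" for a b c
  proof -
    have "\<mu> a c = measure lborel ((A \<inter> {a..b}) \<union> (A \<inter> {b..c}))"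
      unfolding \<mu>_def using that by (intro arg_cong[where f = "measure lborel"]) auto
    also have "\<dots> = \<mu> a b + \<mu> b c"
    proof -
      have "A \<inter> {a..b} \<inter> (A \<inter> {b..c}) \<subseteq> {b}" by auto
      then have "emeasure lborel (A \<inter> {a..b} \<inter> (A \<inter> {b..c})) \<le> emeasure lborel {b}"
        by (intro emeasure_mono) auto
      then have "measure lborel (A \<inter> {a..b} \<inter> (A \<inter> {b..c})) = 0"
        by (simp add: measure_def)
      then show ?thesis unfolding \<mu>_def
        using measure_Un3[OF fin[of a b] fin[of b c]] by simp
    qed
    finally show ?thesis .
  qed
  have nn: "0 \<le> \<mu> a b" and bd: "a \<le> b \<Longrightarrow> \<mu> a b \<le> b - a" for a b
    using measure_mono_fmeasurable[of "A \<inter> {a..b}" "{a..b}" lborel]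
    by (auto simp: \<mu>_def fmeasurable_def)
  have invG: "\<mu> (a + g) (b + g) = \<mu> a b" if "g \<in> G" for a b g
  proof -
    have "\<mu> (a + g) (b + g) = measure (distr lborel borel (\<lambda>x. g + x)) (A \<inter> {a + g..b + g})"
      unfolding \<mu>_def lborel_distr_plus by simp
    also have "\<dots> = measure lborel ((\<lambda>x. g + x) -` (A \<inter> {a + g..b + g}) \<inter> space lborel)"
      by (subst measure_distr) auto
    also have "(\<lambda>x. g + x) -` (A \<inter> {a + g..b + g}) \<inter> space lborel = A \<inter> {a..b}"
      using inv[OF that] by (auto simp: add.commute)
    finally show ?thesis by (simp add: \<mu>_def)
  qed
  have inv1: "\<mu> (a + s) (b + s) \<le> \<mu> a b + 2 * e" if "a \<le> b" "0 < e" for a b s e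
  proof -
    obtain g where g: "g \<in> G" "\<bar>g - s\<bar> < e" using dense[OF \<open>0 < e\<close>, of s] by auto
    have "\<mu> (a + s) (b + s) \<le> \<mu> (a + g - e) (b + g + e)"
      unfolding \<mu>_def using g by (intro measure_mono_fmeasurable fin) auto
    also have "\<dots> = \<mu> (a - e) (b + e)"
      using invG[OF g(1), of "a - e" "b + e"] by (simp add: algebra_simps)
    also have "\<dots> = \<mu> (a - e) a + \<mu> a b + \<mu> b (b + e)"
      using split[of "a - e" a "b + e"] split[of a b "b + e"] that by simp
    also have "\<dots> \<le> \<mu> a b + 2 * e"
      using bd[of "a - e" a] bd[of b "b + e"] that by simp
    finally show ?thesis .
  qed
  have inv2: "\<mu> (a + s) (b + s) \<le> \<mu> a b" if "a \<le> b" for a b s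
    by (rule field_le_epsilon) (use inv1[OF that, of "e / 2" for e] in auto)
  have shift: "\<mu> (a + s) (b + s) = \<mu> a b" if "a \<le> b" for a b s
    using inv2[OF that, of s] inv2[of "a + s" "b + s" "- s"] that by auto
  define c where "c = \<mu> 0 1"
  have lin: "\<mu> 0 t = t * c" if "0 \<le> t" for t
    unfolding c_def
  proof (rule additive_mono_linear[OF _ _ that])
    show "\<mu> 0 (s + t) = \<mu> 0 s + \<mu> 0 t" if "0 \<le> s" "0 \<le> t" for s t
      using split[of 0 s "s + t"] shift[of 0 t s] that by (simp add: add.commute)
    show "\<mu> 0 s \<le> \<mu> 0 t" if "0 \<le> s" "s \<le> t" for s t
      using split[of 0 s t] nn[of s t] that by simp
  qed
  have ab: "\<mu> a b = (b - a) * c" if "a \<le> b" for a b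
    using shift[of 0 "b - a" a] lin[of "b - a"] that by simp
  have em: "emeasure lborel (A \<inter> {a..b}) = ennreal ((b - a) * c)" if "a \<le> b" for a b
    using ab[OF that] fin[of a b] unfolding \<mu>_def
    by (metis emeasure_eq_measure2 fmeasurableD2 emeasure_eq_ennreal_measure infinity_ennreal_def)
  show ?thesis
  proof (cases "c = 0")
    case True
    have "A \<inter> {- real n..real n} \<in> null_sets lborel" for n
      using em[of "- real n" "real n"] True by (auto simp: null_sets_def)
    then have "(\<Union>n. A \<inter> {- real n..real n}) \<in> null_sets lborel"
      by (rule null_sets_UN)
    also have "(\<Union>n. A \<inter> {- real n..real n}) = A"
    proof (intro equalityI subsetI)
      fix t assume t: "t \<in> A"
      obtain n where "\<bar>t\<bar> \<le> real n" using real_arch_simple by blast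
      with t show "t \<in> (\<Union>n. A \<inter> {- real n..real n})" by (auto intro!: exI[of _ n])
    qed auto
    finally show ?thesis by simp
  next
    case False
    then have c: "c > 0" using nn[of 0 1] by (simp add: c_def)
    \<comment> \<open>As \<open>A\<close> fills the same proportion \<open>c\<close> of every
      interval, Lebesgue measure restricted to \<open>A\<close> and divided by \<open>c\<close>
      agrees with Lebesgue measure on boxes, hence everywhere. The restricted measure does not see
      the complement of \<open>A\<close>, which is therefore null.\<close>
    let ?M = "density lborel (\<lambda>x. indicator A x * ennreal (1 / c))"
    have "lborel = ?M"
    proof (rule lborel_eqI)
      fix l u :: real assume "\<And>b. b \<in> Basis \<Longrightarrow> l \<bullet> b \<le> u \<bullet> b"
      then have lu: "l \<le> u" by simp
      have "emeasure ?M (box l u) = (\<integral>\<^sup>+x. ennreal (1 / c) * indicator (A \<inter> {l<..<u}) x \<partial>lborel)"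
        by (subst emeasure_density)
          (auto simp: box_real intro!: nn_integral_cong split: split_indicator)
      also have "\<dots> = ennreal (1 / c) * emeasure lborel (A \<inter> {l<..<u})"
        by (subst nn_integral_cmult_indicator) auto
      also have "emeasure lborel (A \<inter> {l<..<u}) = emeasure lborel (A \<inter> {l..u})"
        by (rule emeasure_eq_AE) (use AE_lborel_singleton[of l] AE_lborel_singleton[of u] in \<open>auto elim!: eventually_rev_mp\<close>)
      also have "ennreal (1 / c) * \<dots> = ennreal (u - l)"
        using c lu by (simp add: em flip: ennreal_mult')
      finally show "emeasure ?M (box l u) = ennreal (\<Prod>b\<in>Basis. (u - l) \<bullet> b)" by simp
    qed simp
    then have "emeasure lborel (- A) = emeasure ?M (- A)" by simp
    also have "\<dots> = 0"
      by (subst emeasure_density) (auto intro!: nn_integral_zero' simp: indicator_def)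
    finally have "- A \<in> null_sets lborel"
      by (intro null_setsI) auto
    then show ?thesis by simp
  qed
qed

section \<open>Ergodicity on trace coordinates\<close>

text \<open>The determinant of the symmetric matrix with diagonal 1 and off-diagonal entries x, y,
  z: the Gram determinant of the unit quaternions 1, inverse of a, and b. Equivalently, the squared
  length of the cross product of the imaginary parts of a and b, so it vanishes exactly when a and b
  commute.\<close>

definition gram :: "real \<Rightarrow> real \<Rightarrow> real \<Rightarrow> real" where
  "gram x y z = 1 - x\<^sup>2 - y\<^sup>2 - z\<^sup>2 + 2 * x * y * z"

text \<open>With x = cos \<alpha> this is (r cos t, r cos (t + \<alpha>)). The square root replaces
  sin \<alpha>, so that no angle has to be chosen and the formula is visibly measurable in all three
  arguments.\<close>

definition ellipse_pt :: "real \<Rightarrow> real \<Rightarrow> real \<Rightarrow> real \<times> real" where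
  "ellipse_pt x r t = (r * cos t, r * (x * cos t - sqrt (1 - x\<^sup>2) * sin t))"

text \<open>The square root inverts \<open>d = (1 - x\<^sup>2) (1 - r\<^sup>2)\<close>; only \<open>x\<^sup>2 < 1\<close> and \<open>0 < d \<le> 1 - x\<^sup>2\<close> are meaningful.\<close>

definition heavy_levels :: "(real \<times> real \<times> real) set \<Rightarrow> (real \<times> real) set" where
  "heavy_levels S = {(x, d). emeasure lborel
     {t \<in> {0..2 * pi}. (x, ellipse_pt x (sqrt (1 - d / (1 - x\<^sup>2))) t) \<in> S} \<noteq> 0}"

lemma gram_measurable [measurable]:
  assumes [measurable]: "f \<in> borel_measurable M" "g \<in> borel_measurable M" "h \<in> borel_measurable M"
  shows "(\<lambda>p. gram (f p) (g p) (h p)) \<in> borel_measurable M"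
  unfolding gram_def by measurable

lemma ellipse_pt_measurable [measurable]:
  assumes [measurable]: "f \<in> borel_measurable M" "g \<in> borel_measurable M" "h \<in> borel_measurable M"
  shows "(\<lambda>p. ellipse_pt (f p) (g p) (h p)) \<in> M \<rightarrow>\<^sub>M borel \<Otimes>\<^sub>M borel"
  unfolding ellipse_pt_def by measurable

lemma heavy_levels_borel:
  assumes "S \<in> sets borel"
  shows "heavy_levels S \<in> sets borel"
proof -
  have [measurable]: "S \<in> sets (borel \<Otimes>\<^sub>M borel \<Otimes>\<^sub>M borel)"
    using assms unfolding borel_prod by simp
  let ?Q = "{p \<in> space (((borel :: real measure) \<Otimes>\<^sub>M (borel :: real measure)) \<Otimes>\<^sub>M (lborel :: real measure)). snd p \<in> {0..2 * pi} \<and>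
    (fst (fst p), ellipse_pt (fst (fst p)) (sqrt (1 - snd (fst p) / (1 - (fst (fst p))\<^sup>2))) (snd p)) \<in> S}"
  have "?Q \<in> sets ((borel \<Otimes>\<^sub>M borel) \<Otimes>\<^sub>M lborel)"
    by measurable
  then have Q: "?Q \<in> sets (borel \<Otimes>\<^sub>M lborel)"
    unfolding borel_prod .
  have "(\<lambda>q. emeasure lborel (Pair q -` ?Q)) \<in> borel_measurable borel"
    using lborel.measurable_emeasure_Pair[OF Q] .
  then have "{q \<in> space borel. emeasure lborel (Pair q -` ?Q) \<noteq> 0} \<in> sets (borel :: (real \<times> real) measure)"
    by measurable
  also have "{q \<in> space borel. emeasure lborel (Pair q -` ?Q) \<noteq> 0} = heavy_levels S"
    by (auto simp: heavy_levels_def vimage_def space_pair_measure)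
  finally show ?thesis .
qed

lemma ellipse_pt_cos:
  assumes "0 \<le> a" "a \<le> pi"
  shows "ellipse_pt (cos a) r t = (r * cos t, r * cos (t + a))"
proof -
  have "sqrt (1 - (cos a)\<^sup>2) = sin a"
    using sin_ge_zero[OF assms] by (simp flip: sin_squared_eq)
  then show ?thesis by (simp add: ellipse_pt_def cos_add mult.commute)
qed

lemma gram_ellipse_pt:
  assumes "x\<^sup>2 < 1"
  shows "gram x (fst (ellipse_pt x r t)) (snd (ellipse_pt x r t)) = (1 - x\<^sup>2) * (1 - r\<^sup>2)"
proof -
  define s where "s = sqrt (1 - x\<^sup>2)"
  have s: "s\<^sup>2 = 1 - x\<^sup>2" using assms by (simp add: s_def)
  have x: "x\<^sup>2 = 1 - s\<^sup>2" using s by simp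
  have c: "(cos t)\<^sup>2 = 1 - (sin t)\<^sup>2" by (simp add: cos_squared_eq)
  have "gram x (fst (ellipse_pt x r t)) (snd (ellipse_pt x r t))
      = 1 - x\<^sup>2 - r\<^sup>2 * ((cos t)\<^sup>2 + (x * cos t - s * sin t)\<^sup>2 - 2 * x * cos t * (x * cos t - s * sin t))"
    by (simp add: gram_def ellipse_pt_def s_def power2_eq_square algebra_simps)
  also have "(cos t)\<^sup>2 + (x * cos t - s * sin t)\<^sup>2 - 2 * x * cos t * (x * cos t - s * sin t)
      = (cos t)\<^sup>2 * (1 - x\<^sup>2) + s\<^sup>2 * (sin t)\<^sup>2"
    by (simp add: power2_eq_square algebra_simps)
  also have "\<dots> = 1 - x\<^sup>2" by (simp add: s c algebra_simps)
  finally show ?thesis by (simp add: algebra_simps)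
qed

lemma ellipse_pt_surj:
  assumes x: "x\<^sup>2 < 1" and g: "0 < gram x y z"
  obtains r t where "0 \<le> r" "r < 1" "ellipse_pt x r t = (y, z)"
proof -
  define s where "s = sqrt (1 - x\<^sup>2)"
  have s: "s\<^sup>2 = 1 - x\<^sup>2" "s > 0" using x by (auto simp: s_def)
  \<comment> \<open>Solving z = x y - s v for v turns the ellipses into circles; r and t are the
    polar coordinates of (y, v).\<close>
  define v where "v = (x * y - z) / s"
  define r where "r = cmod (Complex y v)"
  define t where "t = Arg (Complex y v)"
  have rt: "y = r * cos t" "v = r * sin t" "0 \<le> r"
    using rcis_cmod_Arg[of "Complex y v"] by (auto simp: r_def t_def complex_eq_iff)
  have "z = x * y - s * v" using s by (simp add: v_def)
  then have e: "ellipse_pt x r t = (y, z)" using rt by (simp add: ellipse_pt_def s_def algebra_simps)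
  have "0 < (1 - x\<^sup>2) * (1 - r\<^sup>2)" using gram_ellipse_pt[OF x, of r t] g e by simp
  then have "r < 1" using x rt(3) by (simp add: zero_less_mult_iff power_less_one_iff)
  then show ?thesis using that e rt by blast
qed

text \<open>The exceptional x are cosines of rational multiples of 2 \<pi>, a countable set. The
  alternative \<open>1 \<le> x\<^sup>2\<close> removes the arguments outside the open interval (-1,
  1), which are irrelevant later.\<close>

lemma AE_arccos_irrational: "AE x in lborel. arccos x / (2 * pi) \<notin> \<rat> \<or> 1 \<le> x\<^sup>2"
proof (rule AE_I')
  have "countable ((\<lambda>q. cos (2 * pi * q)) ` \<rat>)" by (simp add: countable_rat)
  then show "(\<lambda>q. cos (2 * pi * q)) ` \<rat> \<in> null_sets lborel"
    by (rule countable_imp_null_set_lborel)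
  show "{x \<in> space lborel. \<not> (arccos x / (2 * pi) \<notin> \<rat> \<or> 1 \<le> x\<^sup>2)} \<subseteq> (\<lambda>q. cos (2 * pi * q)) ` \<rat>"
  proof
    fix x assume "x \<in> {x \<in> space lborel. \<not> (arccos x / (2 * pi) \<notin> \<rat> \<or> 1 \<le> x\<^sup>2)}"
    then have "arccos x / (2 * pi) \<in> \<rat>" "x\<^sup>2 < 1" by auto
    then have "\<bar>x\<bar> < 1" by (simp add: abs_square_less_1)
    with \<open>arccos x / (2 * pi) \<in> \<rat>\<close> show "x \<in> (\<lambda>q. cos (2 * pi * q)) ` \<rat>"
      by (intro image_eqI[of _ _ "arccos x / (2 * pi)"]) (auto simp: cos_arccos abs_le_iff)
  qed
qed

text \<open>By cos t + cos (t + 2 \<alpha>) = 2 cos \<alpha> cos (t + \<alpha>), the map (y, z)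
  \<mapsto> (z, 2 x z - y) acts on the parameter as t \<mapsto> t + \<alpha>. The parameter set is
  thus invariant under the integer combinations of \<alpha> and 2 \<pi>, which are dense when
  \<alpha> / (2 \<pi>) is irrational. So it is null or conull, and its measure in one period tells
  which.\<close>

lemma rotation_invariant_fibre:
  assumes S: "S \<in> sets borel"
    and inv: "\<And>y z. 0 < gram x y z \<Longrightarrow> (x, y, z) \<in> S \<longleftrightarrow> (x, z, 2 * x * z - y) \<in> S"
    and x: "x\<^sup>2 < 1" "arccos x / (2 * pi) \<notin> \<rat>" and r: "0 \<le> r" "r < 1"
  shows "AE t in lborel. (x, ellipse_pt x r t) \<in> S \<longleftrightarrow> (x, (1 - x\<^sup>2) * (1 - r\<^sup>2)) \<in> heavy_levels S"
proof -
  define a where "a = arccos x"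
  have a: "0 \<le> a" "a \<le> pi" "x = cos a"
    using x(1) by (auto simp: a_def abs_square_less_1 abs_less_iff cos_arccos intro!: arccos_lbound arccos_ubound)
  define W where "W = {t. (x, ellipse_pt x r t) \<in> S}"
  have [measurable]: "S \<in> sets (borel \<Otimes>\<^sub>M borel \<Otimes>\<^sub>M borel)"
    using S unfolding borel_prod by simp
  have W [measurable]: "W \<in> sets borel" unfolding W_def by measurable
  have rot: "t + a \<in> W \<longleftrightarrow> t \<in> W" for t
  proof -
    have "0 < gram x (r * cos t) (r * cos (t + a))"
      using gram_ellipse_pt[OF x(1), of r t] x(1) r a by (simp add: ellipse_pt_cos power_less_one_iff abs_square_less_1)
    moreover have "2 * x * (r * cos (t + a)) - r * cos t = r * cos (t + a + a)"
    proof -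
      have "cos (t + a - a) + cos (t + a + a) = 2 * x * cos (t + a)"
        unfolding a(3) by (simp only: cos_diff cos_add) (simp add: algebra_simps)
      then have "r * cos t + r * cos (t + a + a) = r * (2 * x * cos (t + a))"
        by (simp flip: distrib_left)
      then show ?thesis by (simp add: algebra_simps)
    qed
    ultimately show ?thesis
      using inv[of "r * cos t" "r * cos (t + a)"] a unfolding W_def by (simp add: ellipse_pt_cos)
  qed
  have per: "t + 2 * pi * of_int h \<in> W \<longleftrightarrow> t \<in> W" for t h
  proof -
    have "cos (t + 2 * pi * of_int h) = cos t" "sin (t + 2 * pi * of_int h) = sin t"
      unfolding cos_add sin_add cos_int_2pin sin_int_2pin by simp_all
    then show ?thesis by (simp add: W_def ellipse_pt_def)
  qed
  have rotn: "t + real n * a \<in> W \<longleftrightarrow> t \<in> W" for t n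
  proof (induction n)
    case (Suc n)
    have "t + real (Suc n) * a = (t + real n * a) + a" by (simp add: algebra_simps)
    then show ?case using rot Suc by metis
  qed simp
  have roti: "t + of_int k * a \<in> W \<longleftrightarrow> t \<in> W" for t and k :: int
  proof (cases k rule: int_cases2)
    case (nonneg n) then show ?thesis using rotn by simp
  next
    case (nonpos n) then show ?thesis using rotn[of "t - real n * a" n] by simp
  qed
  define G where "G = {of_int k * a + 2 * pi * of_int h |k h. True}"
  have disj: "W \<in> null_sets lborel \<or> - W \<in> null_sets lborel"
  proof (rule dense_translation_invariant_null[OF W, of G])
    show "t + g \<in> W \<longleftrightarrow> t \<in> W" if "g \<in> G" for t g
      using that roti per by (auto simp: G_def simp flip: add.assoc)
    show "\<exists>g\<in>G. \<bar>g - t\<bar> < e" if e: "0 < e" for t e :: real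
    proof -
      \<comment> \<open>Density of the fractional parts of the multiples of \<alpha> / (2 \<pi>),
        rescaled by 2 \<pi>.\<close>
      obtain h k where "\<bar>of_int k * (a / (2 * pi)) - of_int h - t / (2 * pi)\<bar> < e / (2 * pi)"
        by (rule sequence_of_fractional_parts_is_dense[of "a / (2 * pi)" "e / (2 * pi)" "t / (2 * pi)"])
          (use x e in \<open>auto simp: a_def\<close>)
      then have "2 * pi * \<bar>of_int k * (a / (2 * pi)) - of_int h - t / (2 * pi)\<bar> < e"
        by (simp add: field_simps)
      also have "2 * pi * \<bar>of_int k * (a / (2 * pi)) - of_int h - t / (2 * pi)\<bar>
          = \<bar>2 * pi * (of_int k * (a / (2 * pi)) - of_int h - t / (2 * pi))\<bar>"
        by (simp add: abs_mult)
      also have "2 * pi * (of_int k * (a / (2 * pi)) - of_int h - t / (2 * pi))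
          = of_int k * a + 2 * pi * of_int (- h) - t"
        by (simp add: field_simps)
      finally show ?thesis unfolding G_def by blast
    qed
  qed
  have heavy: "(x, (1 - x\<^sup>2) * (1 - r\<^sup>2)) \<in> heavy_levels S \<longleftrightarrow> emeasure lborel (W \<inter> {0..2 * pi}) \<noteq> 0"
  proof -
    have "sqrt (1 - (1 - x\<^sup>2) * (1 - r\<^sup>2) / (1 - x\<^sup>2)) = r" using x(1) r by simp
    moreover have "{t \<in> {0..2 * pi}. (x, ellipse_pt x r t) \<in> S} = W \<inter> {0..2 * pi}"
      by (auto simp: W_def)
    ultimately show ?thesis by (simp add: heavy_levels_def)
  qed
  from disj show ?thesis
  proof
    assume N: "W \<in> null_sets lborel"
    then have "emeasure lborel (W \<inter> {0..2 * pi}) = 0"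
      using null_set_Int2[OF N, of "{0..2 * pi}"] by (simp add: null_setsD1)
    then show ?thesis using AE_not_in[OF N] heavy by (auto simp: W_def)
  next
    assume N: "- W \<in> null_sets lborel"
    have "emeasure lborel (W \<inter> {0..2 * pi}) = emeasure lborel {0..2 * pi}"
      by (rule emeasure_eq_AE) (use AE_not_in[OF N] in auto)
    then have "emeasure lborel (W \<inter> {0..2 * pi}) \<noteq> 0" by simp
    then show ?thesis using AE_not_in[OF N] heavy by (auto simp: W_def)
  qed
qed

section \<open>Null sets of traces and of levels\<close>

text \<open>Away from the vertex c, the preimage consists of the images of N under the two branches
  c \<plusminus> sqrt ((n - a) / b), which are differentiable where the radicand is positive. The
  vertex adds a single point.\<close>

lemma negligible_preimage_quadratic:
  fixes N :: "real set"
  assumes N: "negligible N" and b: "b \<noteq> 0"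
  shows "negligible {z. a + b * (z - c)\<^sup>2 \<in> N}"
proof -
  let ?N = "N \<inter> {n. 0 < (n - a) / b}"
  have d: "(\<lambda>n. c + e * sqrt ((n - a) / b)) differentiable_on ?N" for e
  proof (rule differentiable_at_imp_differentiable_on)
    fix n assume n: "n \<in> ?N"
    have "((\<lambda>n. c + e * sqrt ((n - a) / b)) has_field_derivative
        e * (inverse (sqrt ((n - a) / b)) / 2 * (1 / b))) (at n)"
      using n b by (auto intro!: derivative_eq_intros)
    then show "(\<lambda>n. c + e * sqrt ((n - a) / b)) differentiable at n"
      by (metis differentiableI has_field_derivative_def)
  qed
  have "negligible ((\<lambda>n. c + e * sqrt ((n - a) / b)) ` ?N)" for e
    by (rule negligible_differentiable_image_negligible[OF _ _ d]) (use N in \<open>auto intro: negligible_Int\<close>)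
  from this[of 1] this[of "-1"]
  have "negligible ({c} \<union> (\<lambda>n. c + 1 * sqrt ((n - a) / b)) ` ?N \<union> (\<lambda>n. c + (-1) * sqrt ((n - a) / b)) ` ?N)"
    by (intro negligible_Un negligible_sing)
  then show ?thesis
  proof (rule negligible_subset)
    show "{z. a + b * (z - c)\<^sup>2 \<in> N} \<subseteq> {c} \<union> (\<lambda>n. c + 1 * sqrt ((n - a) / b)) ` ?N \<union> (\<lambda>n. c + (-1) * sqrt ((n - a) / b)) ` ?N"
    proof
      fix z assume z: "z \<in> {z. a + b * (z - c)\<^sup>2 \<in> N}"
      have q: "(a + b * (z - c)\<^sup>2 - a) / b = (z - c)\<^sup>2" using b by simp
      consider "z = c" | "z > c" | "z < c" by linarith
      then show "z \<in> {c} \<union> (\<lambda>n. c + 1 * sqrt ((n - a) / b)) ` ?N \<union> (\<lambda>n. c + (-1) * sqrt ((n - a) / b)) ` ?N"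
      proof cases
        case 2
        then have "z \<in> (\<lambda>n. c + 1 * sqrt ((n - a) / b)) ` ?N"
          using z q by (intro image_eqI[of _ _ "a + b * (z - c)\<^sup>2"]) auto
        then show ?thesis by blast
      next
        case 3
        then have "z \<in> (\<lambda>n. c + (-1) * sqrt ((n - a) / b)) ` ?N"
          using z q by (intro image_eqI[of _ _ "a + b * (z - c)\<^sup>2"]) auto
        then show ?thesis by blast
      qed simp
    qed
  qed
qed

text \<open>Completing the square in z; the factor -1 is kept explicit to match the shape a + b (z -
  c)^2 of \<open>AE_preimage_quadratic\<close>. The maximum over z is (1 - x^2)(1 - y^2), which
  bounds the levels that x and y have in common.\<close>

lemma gram_eq: "gram x y z = (1 - x\<^sup>2) * (1 - y\<^sup>2) + (-1) * (z - x * y)\<^sup>2"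
  by (simp add: gram_def power2_eq_square algebra_simps)

lemma AE_lborel_iff_negligible:
  fixes P :: "'a::euclidean_space \<Rightarrow> bool"
  shows "(AE x in lborel. P x) \<longleftrightarrow> negligible {x. \<not> P x}"
  using completion.AE_iff_null_sets[of P lborel]
  by (simp add: negligible_iff_null_sets AE_completion_iff)

lemma AE_preimage_quadratic:
  fixes P :: "real \<Rightarrow> bool"
  assumes "AE d in lborel. P d" "b \<noteq> 0"
  shows "AE z in lborel. P (a + b * (z - c)\<^sup>2)"
  using negligible_preimage_quadratic[of "{d. \<not> P d}" b a c] assms
  by (simp add: AE_lborel_iff_negligible)

lemma AE_gram_preimage:
  assumes "AE d in lborel. P d"
  shows "AE z in lborel. P (gram x y z)"
  using AE_preimage_quadratic[OF assms, of "-1"] by (simp only: gram_eq)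

lemma AE_gram_image:
  assumes ae: "AE z in lborel. 0 < gram x y z \<longrightarrow> P (gram x y z)"
  shows "AE d in lborel. 0 < d \<and> d < (1 - x\<^sup>2) * (1 - y\<^sup>2) \<longrightarrow> P d"
proof -
  have "negligible {z. \<not> (0 < gram x y z \<longrightarrow> P (gram x y z))}"
    using ae by (simp add: AE_lborel_iff_negligible)
  moreover have "gram x y differentiable_on A" for A
    unfolding gram_def by (intro differentiable_at_imp_differentiable_on derivative_intros)
  ultimately have "negligible (gram x y ` {z. \<not> (0 < gram x y z \<longrightarrow> P (gram x y z))})"
    by (intro negligible_differentiable_image_negligible) auto
  then have "negligible {d. \<not> (0 < d \<and> d < (1 - x\<^sup>2) * (1 - y\<^sup>2) \<longrightarrow> P d)}"
  proof (rule negligible_subset, intro subsetI)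
    fix d assume d: "d \<in> {d. \<not> (0 < d \<and> d < (1 - x\<^sup>2) * (1 - y\<^sup>2) \<longrightarrow> P d)}"
    \<comment> \<open>Every level below the maximum is attained on the right branch of the parabola,
      so bad levels are images of bad z under a polynomial.\<close>
    have "gram x y (x * y + sqrt ((1 - x\<^sup>2) * (1 - y\<^sup>2) - d)) = d"
      using d by (simp add: gram_eq)
    then show "d \<in> gram x y ` {z. \<not> (0 < gram x y z \<longrightarrow> P (gram x y z))}"
      using d by (intro image_eqI[of _ _ "x * y + sqrt ((1 - x\<^sup>2) * (1 - y\<^sup>2) - d)"]) auto
  qed
  then show ?thesis by (simp add: AE_lborel_iff_negligible)
qed

text \<open>Fubini assembles the statements for single ellipses into one for almost every pair (r,
  t). The differentiable map \<open>ellipse_pt\<close> carries the exceptional pairs to a null set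
  of (y, z), and by \<open>ellipse_pt_surj\<close> it reaches every point with positive Gram
  value.\<close>

lemma AE_fibre_levels:
  assumes S: "S \<in> sets borel"
    and inv: "\<And>y z. 0 < gram x y z \<Longrightarrow> (x, y, z) \<in> S \<longleftrightarrow> (x, z, 2 * x * z - y) \<in> S"
    and x: "x\<^sup>2 < 1" "arccos x / (2 * pi) \<notin> \<rat>"
  shows "AE p in lborel. 0 < gram x (fst p) (snd p) \<longrightarrow>
    ((x, p) \<in> S \<longleftrightarrow> (x, gram x (fst p) (snd p)) \<in> heavy_levels S)"
proof -
  have [measurable]: "S \<in> sets (borel \<Otimes>\<^sub>M borel \<Otimes>\<^sub>M borel)" "heavy_levels S \<in> sets (borel \<Otimes>\<^sub>M borel)"
    using S heavy_levels_borel[OF S] unfolding borel_prod by simp_all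
  let ?P = "\<lambda>p. 0 \<le> fst p \<and> fst p < 1 \<longrightarrow>
    ((x, ellipse_pt x (fst p) (snd p)) \<in> S \<longleftrightarrow> (x, (1 - x\<^sup>2) * (1 - (fst p)\<^sup>2)) \<in> heavy_levels S)"
  have "AE p in lborel \<Otimes>\<^sub>M lborel. ?P p"
  proof (rule lborel_pair.AE_pair_measure)
    show "{p \<in> space (lborel \<Otimes>\<^sub>M lborel). ?P p} \<in> sets (lborel \<Otimes>\<^sub>M lborel)"
      by measurable
    show "AE r in lborel. AE t in lborel. ?P (r, t)"
      using rotation_invariant_fibre[OF S inv x] by auto
  qed
  then have "negligible {p. \<not> ?P p}"
    unfolding lborel_prod AE_lborel_iff_negligible .
  moreover have "(\<lambda>p. ellipse_pt x (fst p) (snd p)) differentiable_on A" for A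
    unfolding ellipse_pt_def
    by (intro differentiable_at_imp_differentiable_on, unfold differentiable_def, intro exI)
      (rule derivative_eq_intros refl)+
  ultimately have "negligible ((\<lambda>p. ellipse_pt x (fst p) (snd p)) ` {p. \<not> ?P p})"
    by (intro negligible_differentiable_image_negligible) auto
  then have "negligible {p. \<not> (0 < gram x (fst p) (snd p) \<longrightarrow>
    ((x, p) \<in> S \<longleftrightarrow> (x, gram x (fst p) (snd p)) \<in> heavy_levels S))}"
  proof (rule negligible_subset, intro subsetI)
    fix p assume p: "p \<in> {p. \<not> (0 < gram x (fst p) (snd p) \<longrightarrow>
      ((x, p) \<in> S \<longleftrightarrow> (x, gram x (fst p) (snd p)) \<in> heavy_levels S))}"
    obtain r t where "0 \<le> r" "r < 1" and e: "ellipse_pt x r t = p"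
      using ellipse_pt_surj[OF x(1), of "fst p" "snd p"] p by auto
    then show "p \<in> (\<lambda>p. ellipse_pt x (fst p) (snd p)) ` {p. \<not> ?P p}"
      using p gram_ellipse_pt[OF x(1), of r t] by (intro image_eqI[of _ _ "(r, t)"]) auto
  qed
  then show ?thesis by (simp add: AE_lborel_iff_negligible)
qed

section \<open>The self-improving set of levels\<close>

text \<open>After exchanging the quantifiers, a typical d lies in \<open>T\<close> as soon as 4 x^2
  d meets \<open>T\<close> for a positive measure of admissible x, that is, as soon as
  \<open>T\<close> has positive measure in (0, 4 d (1 - d)). Positive measure in some (0, t) with t
  < 1 is pushed to (0, 1/2), then down geometrically to 0, and finally every d qualifies.\<close>

lemma self_improving_set:
  fixes T :: "real set"
  assumes T: "T \<in> sets borel"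
    and ae: "AE x in lborel. AE d in lborel. 0 < d \<and> d < 1 - x\<^sup>2 \<longrightarrow> 4 * x\<^sup>2 * d \<in> T \<longrightarrow> d \<in> T"
  shows "(AE d in lborel. 0 < d \<and> d < 1 \<longrightarrow> d \<notin> T) \<or> (AE d in lborel. 0 < d \<and> d < 1 \<longrightarrow> d \<in> T)"
proof -
  note [measurable] = T
  define big where "big t \<longleftrightarrow> \<not> negligible (T \<inter> {0<..<t})" for t
  have big_mono: "big t" if "big s" "s \<le> t" for s t
  proof -
    have "T \<inter> {0<..<s} \<subseteq> T \<inter> {0<..<t}" using that by auto
    then show ?thesis using that negligible_subset unfolding big_def by blast
  qed
  have "AE d in lborel. AE x in lborel. 0 < d \<and> d < 1 - x\<^sup>2 \<longrightarrow> 4 * x\<^sup>2 * d \<in> T \<longrightarrow> d \<in> T"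
  proof (rule iffD1[OF lborel_pair.AE_commute ae])
    show "{p \<in> space (lborel \<Otimes>\<^sub>M lborel). 0 < snd p \<and> snd p < 1 - (fst p)\<^sup>2 \<longrightarrow>
        4 * (fst p)\<^sup>2 * snd p \<in> T \<longrightarrow> snd p \<in> T} \<in> sets (lborel \<Otimes>\<^sub>M lborel)"
      by measurable
  qed
  then have key: "AE d in lborel. 0 < d \<and> d < 1 \<and> big (4 * d * (1 - d)) \<longrightarrow> d \<in> T"
  proof (rule AE_mp, intro AE_I2 impI)
    fix d assume ax: "AE x in lborel. 0 < d \<and> d < 1 - x\<^sup>2 \<longrightarrow> 4 * x\<^sup>2 * d \<in> T \<longrightarrow> d \<in> T"
      and d: "0 < d \<and> d < 1 \<and> big (4 * d * (1 - d))"
    show "d \<in> T"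
    proof (rule ccontr)
      assume nd: "d \<notin> T"
      have "AE x in lborel. \<not> (x\<^sup>2 < 1 - d \<and> 4 * x\<^sup>2 * d \<in> T)"
        by (rule eventually_mono[OF ax]) (use d nd in auto)
      then have "negligible {x. x\<^sup>2 < 1 - d \<and> 4 * x\<^sup>2 * d \<in> T}"
        by (simp add: AE_lborel_iff_negligible)
      then have "negligible ((\<lambda>x. 4 * x\<^sup>2 * d) ` {x. x\<^sup>2 < 1 - d \<and> 4 * x\<^sup>2 * d \<in> T})"
        by (rule negligible_differentiable_image_negligible[rotated])
          (auto intro!: differentiable_at_imp_differentiable_on derivative_intros)
      \<comment> \<open>A point t of this interval comes from x = sqrt (t / (4 d)), and t < 4 d (1 -
        d) says precisely x^2 < 1 - d.\<close>
      then have "negligible (T \<inter> {0<..<4 * d * (1 - d)})"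
      proof (rule negligible_subset, intro subsetI)
        fix t assume t: "t \<in> T \<inter> {0<..<4 * d * (1 - d)}"
        then have "t / (4 * d) < 1 - d" using d by (simp add: field_simps)
        then show "t \<in> (\<lambda>x. 4 * x\<^sup>2 * d) ` {x. x\<^sup>2 < 1 - d \<and> 4 * x\<^sup>2 * d \<in> T}"
          using t d by (intro image_eqI[of _ _ "sqrt (t / (4 * d))"]) auto
      qed
      then show False using d by (simp add: big_def)
    qed
  qed
  \<comment> \<open>If all d between u and v are absorbed, then \<open>T\<close> contains almost all
    of that interval, so it has positive measure below v.\<close>
  have step: "big v" if "0 \<le> u" "u < v" "v < 1" and b: "\<And>d. u < d \<Longrightarrow> d < v \<Longrightarrow> big (4 * d * (1 - d))" for u v
    unfolding big_def
  proof
    assume "negligible (T \<inter> {0<..<v})"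
    moreover have "negligible {d. \<not> (0 < d \<and> d < 1 \<and> big (4 * d * (1 - d)) \<longrightarrow> d \<in> T)}"
      using key by (simp add: AE_lborel_iff_negligible)
    ultimately have "negligible ((T \<inter> {0<..<v}) \<union> {d. \<not> (0 < d \<and> d < 1 \<and> big (4 * d * (1 - d)) \<longrightarrow> d \<in> T)})"
      by (rule negligible_Un)
    then have "negligible {u<..<v}"
      by (rule negligible_subset) (use that in auto)
    then show False using that(2) negligible_interval(2)[of u v] by (simp add: box_real)
  qed
  show ?thesis
  proof (cases "big 1")
    case False
    then have "negligible (T \<inter> {0<..<1})" by (simp add: big_def)
    then show ?thesis by (auto simp: AE_lborel_iff_negligible elim!: negligible_subset)
  next
    case True
    \<comment> \<open>Countable additivity lowers the end point 1 to some t < 1; the shift by 2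
      keeps the end points positive already at n = 0.\<close>
    have "\<exists>n::nat. big (1 - 1 / (real n + 2))"
    proof (rule ccontr)
      assume "\<nexists>n::nat. big (1 - 1 / (real n + 2))"
      then have "negligible (\<Union>n::nat. T \<inter> {0<..<1 - 1 / (real n + 2)})"
        by (intro negligible_countable_Union) (auto simp: big_def)
      then have "negligible (T \<inter> {0<..<1})"
      proof (rule negligible_subset, intro subsetI)
        fix t assume t: "t \<in> T \<inter> {0<..<1}"
        obtain n where "inverse (real (Suc n)) < 1 - t"
          using reals_Archimedean[of "1 - t"] t by auto
        moreover have "1 / (real n + 2) \<le> inverse (real (Suc n))" by (simp add: field_simps)
        ultimately show "t \<in> (\<Union>n. T \<inter> {0<..<1 - 1 / (real n + 2)})"
          using t by (intro UN_I[of n]) auto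
      qed
      with True show False by (simp add: big_def)
    qed
    then obtain t where t: "big t" "0 < t" "t < 1" by (auto simp: field_simps)
    \<comment> \<open>For t/2 < d < 1/2 one has 4 d (1 - d) \<ge> 2 d > t.\<close>
    have half: "big (1 / 2)"
    proof (rule step[of "t / 2"])
      fix d assume d: "t / 2 < d" "d < 1 / 2"
      have "(1 - 2 * d) * (1 - 2 * d) \<le> (1 - 2 * d) * 1"
        using d t by (intro mult_left_mono) auto
      then have "t \<le> 4 * d * (1 - d)" using d by (simp add: algebra_simps)
      then show "big (4 * d * (1 - d))" using t big_mono by blast
    qed (use t in auto)
    \<comment> \<open>For t \<le> 1/2 and d < 3 t / 4 one has d < 3/8, hence 4 (1 - d) > 5/2 and,
      with d > t/2, 4 d (1 - d) > t.\<close>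
    have shrink: "big (3 / 4 * t)" if t: "big t" "0 < t" "t \<le> 1 / 2" for t
    proof (rule step[of "t / 2"])
      fix d assume d: "t / 2 < d" "d < 3 / 4 * t"
      have "d * (5 / 2) \<le> d * (4 * (1 - d))" using d t by (intro mult_left_mono) auto
      then have "t \<le> 4 * d * (1 - d)" using d t by (simp add: algebra_simps)
      then show "big (4 * d * (1 - d))" using t big_mono by blast
    qed (use t in auto)
    have "big ((3 / 4) ^ n * (1 / 2))" for n
    proof (induction n)
      case (Suc n)
      have "(3 / 4 :: real) ^ n \<le> 1" by (rule power_le_one) auto
      then show ?case using shrink[OF Suc] by simp
    qed (use half in simp)
    moreover have "\<exists>n. (3 / 4 :: real) ^ n * (1 / 2) \<le> t" if t0: "0 < t" for t
    proof -
      obtain n where "(3 / 4 :: real) ^ n < t" using real_arch_pow_inv[of t "3 / 4"] t0 by auto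
      moreover have "(0::real) \<le> (3 / 4) ^ n" by simp
      ultimately show ?thesis by (intro exI[of _ n]) linarith
    qed
    ultimately have "big t" if "0 < t" for t using that big_mono by blast
    then have "AE d in lborel. 0 < d \<and> d < 1 \<longrightarrow> d \<in> T"
      by (intro eventually_mono[OF key]) auto
    then show ?thesis ..
  qed
qed

text \<open>A full-measure set of good fibres is replaced by countably many of them near 0, so that
  their exceptional null sets can be united.\<close>

lemma AE_obtain_sequence:
  assumes "AE y in lborel. Q (y::real)"
  obtains Y where "\<And>n. Q (Y n)" "Y \<longlonglongrightarrow> 0"
proof -
  have "\<exists>y. Q y \<and> 0 < y \<and> y < inverse (real (Suc n))" for n
  proof (rule ccontr)
    assume "\<nexists>y. Q y \<and> 0 < y \<and> y < inverse (real (Suc n))"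
    then have "{0<..<inverse (real (Suc n))} \<subseteq> {y. \<not> Q y}" by auto
    then have "negligible {0<..<inverse (real (Suc n))}"
      using assms by (auto simp: AE_lborel_iff_negligible intro: negligible_subset)
    then show False using negligible_interval(2)[of 0 "inverse (real (Suc n))"] by (simp add: box_real)
  qed
  then obtain Y where Y: "\<And>n. Q (Y n) \<and> 0 < Y n \<and> Y n < inverse (real (Suc n))" by metis
  have "Y \<longlonglongrightarrow> 0"
    by (rule tendsto_sandwich[OF _ _ tendsto_const LIMSEQ_inverse_real_of_nat])
      (use Y in \<open>auto intro!: always_eventually less_imp_le\<close>)
  then show ?thesis using that Y by blast
qed

lemma eventually_level:
  fixes Y :: "nat \<Rightarrow> real"
  assumes "Y \<longlonglongrightarrow> 0" "d < c"
  shows "eventually (\<lambda>n. d < c * (1 - (Y n)\<^sup>2)) sequentially"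
proof -
  have "(\<lambda>n. c * (1 - (Y n)\<^sup>2)) \<longlonglongrightarrow> c * (1 - 0\<^sup>2)" by (intro tendsto_intros assms)
  then show ?thesis using order_tendstoD(1)[of _ c sequentially d] assms(2) by simp
qed

text \<open>A fixed y controls only the levels below c (1 - y^2). Along good values of y tending to
  0 these intervals exhaust (0, c).\<close>

lemma AE_level_sweep:
  assumes "AE y in lborel. AE d in lborel. 0 < d \<and> d < c * (1 - y\<^sup>2) \<longrightarrow> U d"
  shows "AE d in lborel. 0 < d \<and> d < c \<longrightarrow> U (d::real)"
proof -
  obtain Y where Y: "\<And>n. AE d in lborel. 0 < d \<and> d < c * (1 - (Y n)\<^sup>2) \<longrightarrow> U d" "Y \<longlonglongrightarrow> 0"
    using AE_obtain_sequence[OF assms] by blast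
  have "AE d in lborel. \<forall>n. 0 < d \<and> d < c * (1 - (Y n)\<^sup>2) \<longrightarrow> U d"
    unfolding AE_all_countable using Y(1) by blast
  then show ?thesis
  proof (rule AE_mp, intro AE_I2 impI)
    fix d assume "\<forall>n. 0 < d \<and> d < c * (1 - (Y n)\<^sup>2) \<longrightarrow> U d" "0 < d \<and> d < c"
    moreover obtain n where "d < c * (1 - (Y n)\<^sup>2)"
      using eventually_level[OF Y(2), of d c] calculation(2) by (auto simp: eventually_sequentially)
    ultimately show "U d" by blast
  qed
qed

lemma AE_preimage_affine:
  fixes P :: "real \<Rightarrow> bool"
  assumes ae: "AE z in lborel. P z" and b: "b \<noteq> 0"
  shows "AE z in lborel. P (b * z - a)"
proof -
  have "negligible ((\<lambda>z. (z + a) / b) ` {z. \<not> P z})"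
    by (rule negligible_differentiable_image_negligible)
      (use ae in \<open>auto simp: AE_lborel_iff_negligible divide_inverse intro!: differentiable_at_imp_differentiable_on derivative_intros\<close>)
  then have "negligible {z. \<not> P (b * z - a)}"
  proof (rule negligible_subset, intro subsetI)
    fix z assume "z \<in> {z. \<not> P (b * z - a)}"
    then show "z \<in> (\<lambda>z. (z + a) / b) ` {z. \<not> P z}"
      using b by (intro image_eqI[of _ _ "b * z - a"]) auto
  qed
  then show ?thesis by (simp add: AE_lborel_iff_negligible)
qed

text \<open>For a Borel predicate, iterated almost-everywhere quantifiers amount to one over
  three-dimensional space, where exchanging two coordinates is linear and preserves null
  sets.\<close>

lemma AE_swap_first_two:
  fixes P :: "real \<Rightarrow> real \<Rightarrow> real \<Rightarrow> bool"
  assumes P: "{p. P (fst p) (fst (snd p)) (snd (snd p))} \<in> sets borel"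
    and ae: "AE x in lborel. AE y in lborel. AE z in lborel. P x y z"
  shows "AE y in lborel. AE x in lborel. AE z in lborel. P x y z"
proof -
  have P': "{p \<in> space (lborel \<Otimes>\<^sub>M lborel \<Otimes>\<^sub>M lborel). P (fst p) (fst (snd p)) (snd (snd p))} \<in> sets (lborel \<Otimes>\<^sub>M lborel \<Otimes>\<^sub>M lborel)"
    using P unfolding lborel_prod by simp
  have sec: "{q \<in> space (lborel \<Otimes>\<^sub>M lborel). P x (fst q) (snd q)} \<in> sets (lborel \<Otimes>\<^sub>M lborel)" for x
    using measurable_sets[OF measurable_Pair1'[of x lborel "lborel \<Otimes>\<^sub>M lborel"] P'] by (simp add: vimage_def space_pair_measure)
  have "AE x in lborel. AE q in lborel \<Otimes>\<^sub>M lborel. P x (fst q) (snd q)"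
    using ae by eventually_elim (rule lborel_pair.AE_pair_measure[OF sec], simp)
  then have "AE x in lborel. AE q in lborel. P x (fst q) (snd q)"
    unfolding lborel_prod .
  then have "AE p in lborel \<Otimes>\<^sub>M lborel. P (fst p) (fst (snd p)) (snd (snd p))"
    using P' unfolding lborel_prod[where ?'a = real and ?'b = real] by (intro lborel_pair.AE_pair_measure) simp_all
  then have n: "negligible {p. \<not> P (fst p) (fst (snd p)) (snd (snd p))}"
    unfolding lborel_prod AE_lborel_iff_negligible .
  have "(\<lambda>p::real \<times> real \<times> real. (fst (snd p), fst p, snd (snd p))) differentiable_on A" for A
    by (intro differentiable_at_imp_differentiable_on, unfold differentiable_def, intro exI)
      (rule derivative_eq_intros refl)+
  then have "negligible ((\<lambda>p. (fst (snd p), fst p, snd (snd p))) ` {p. \<not> P (fst p) (fst (snd p)) (snd (snd p))})"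
    by (intro negligible_differentiable_image_negligible n) auto
  then have "negligible {p. \<not> P (fst (snd p)) (fst p) (snd (snd p))}"
    by (rule negligible_subset) (force simp: image_iff)
  then have "AE p in lborel. P (fst (snd p)) (fst p) (snd (snd p))"
    by (simp add: AE_lborel_iff_negligible)
  then have "AE p in lborel \<Otimes>\<^sub>M lborel \<Otimes>\<^sub>M lborel. P (fst (snd p)) (fst p) (snd (snd p))"
    unfolding lborel_prod .
  then have "AE y in lborel. AE q in lborel \<Otimes>\<^sub>M lborel. P (fst q) y (snd q)"
    using lborel_pair.AE_pair[of "\<lambda>p. P (fst (snd p)) (fst p) (snd (snd p))"] unfolding lborel_prod by simp
  then show ?thesis
    by eventually_elim (drule lborel_pair.AE_pair, simp)
qed

lemma gram_bound:
  assumes "x\<^sup>2 < 1" "y \<noteq> 0"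
  shows "gram x y z < 1 - x\<^sup>2"
proof -
  have "gram x y z \<le> (1 - x\<^sup>2) * (1 - y\<^sup>2)" by (simp add: gram_eq)
  also have "\<dots> < (1 - x\<^sup>2) * 1" using assms by (intro mult_strict_left_mono) auto
  finally show ?thesis by simp
qed

text \<open>The arguments on the left are the half traces of a^2, b and a^2 b. The imaginary part of
  a^2 is 2 x times that of a, whence the factor 4 x^2.\<close>

lemma gram_double:
  "gram (2 * x\<^sup>2 - 1) y (2 * x * z - y) = 4 * x\<^sup>2 * gram x y z"
  by (simp add: gram_def power2_eq_square algebra_simps)

lemma gram_swap: "gram y x z = gram x y z"
  by (simp add: gram_def algebra_simps)

lemma AE_heavy_levels:
  assumes S: "S \<in> sets borel"
    and inv: "\<And>x y z. x\<^sup>2 < 1 \<Longrightarrow> 0 < gram x y z \<Longrightarrow> (x, y, z) \<in> S \<longleftrightarrow> (x, z, 2 * x * z - y) \<in> S"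
  shows "AE x in lborel. AE y in lborel. AE z in lborel. x\<^sup>2 < 1 \<longrightarrow> 0 < gram x y z \<longrightarrow>
    ((x, y, z) \<in> S \<longleftrightarrow> (x, gram x y z) \<in> heavy_levels S)"
proof (rule eventually_mono[OF AE_arccos_irrational])
  fix x :: real assume irr: "arccos x / (2 * pi) \<notin> \<rat> \<or> 1 \<le> x\<^sup>2"
  show "AE y in lborel. AE z in lborel. x\<^sup>2 < 1 \<longrightarrow> 0 < gram x y z \<longrightarrow>
    ((x, y, z) \<in> S \<longleftrightarrow> (x, gram x y z) \<in> heavy_levels S)"
  proof (cases "x\<^sup>2 < 1")
    case True
    then have irr': "arccos x / (2 * pi) \<notin> \<rat>" using irr by auto
    have "AE p in lborel \<Otimes>\<^sub>M lborel. 0 < gram x (fst p) (snd p) \<longrightarrow>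
      ((x, p) \<in> S \<longleftrightarrow> (x, gram x (fst p) (snd p)) \<in> heavy_levels S)"
      unfolding lborel_prod by (rule AE_fibre_levels[OF S inv[OF True] True irr'])
    from lborel_pair.AE_pair[OF this] show ?thesis
      by (rule eventually_mono) (auto elim: eventually_mono)
  qed auto
qed

text \<open>The hypotheses \<open>inv\<close>, \<open>sym\<close> and \<open>double\<close> are the
  trace forms of (a, b) \<mapsto> (a, a b), (a, b) \<mapsto> (b, a), and the one-sided implication
  from (a^2, b) to (a, b).\<close>

lemma invariant_null_or_conull:
  assumes S: "S \<in> sets borel"
    and inv: "\<And>x y z. x\<^sup>2 < 1 \<Longrightarrow> 0 < gram x y z \<Longrightarrow> (x, y, z) \<in> S \<longleftrightarrow> (x, z, 2 * x * z - y) \<in> S"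
    and sym: "\<And>x y z. x\<^sup>2 < 1 \<Longrightarrow> 0 < gram x y z \<Longrightarrow> (x, y, z) \<in> S \<longleftrightarrow> (y, x, z) \<in> S"
    and double: "\<And>x y z. x\<^sup>2 < 1 \<Longrightarrow> 0 < gram x y z \<Longrightarrow> x \<noteq> 0 \<Longrightarrow>
      (2 * x\<^sup>2 - 1, y, 2 * x * z - y) \<in> S \<Longrightarrow> (x, y, z) \<in> S"
  shows "(AE x in lborel. AE y in lborel. AE z in lborel. x\<^sup>2 < 1 \<longrightarrow> 0 < gram x y z \<longrightarrow> (x, y, z) \<notin> S) \<or>
    (AE x in lborel. AE y in lborel. AE z in lborel. x\<^sup>2 < 1 \<longrightarrow> 0 < gram x y z \<longrightarrow> (x, y, z) \<in> S)"
proof -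
  define H where "H = heavy_levels S"
  have H: "H \<in> sets borel" unfolding H_def by (rule heavy_levels_borel[OF S])
  have [measurable]: "S \<in> sets (borel \<Otimes>\<^sub>M borel \<Otimes>\<^sub>M borel)" "H \<in> sets (borel \<Otimes>\<^sub>M borel)"
    using S H unfolding borel_prod by simp_all
  have lev: "AE x in lborel. AE y in lborel. AE z in lborel. x\<^sup>2 < 1 \<longrightarrow> 0 < gram x y z \<longrightarrow>
      ((x, y, z) \<in> S \<longleftrightarrow> (x, gram x y z) \<in> H)"
    unfolding H_def by (rule AE_heavy_levels[OF S inv])
  have lev': "AE y in lborel. AE x in lborel. AE z in lborel. x\<^sup>2 < 1 \<longrightarrow> 0 < gram x y z \<longrightarrow>
      ((x, y, z) \<in> S \<longleftrightarrow> (x, gram x y z) \<in> H)"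
  proof (rule AE_swap_first_two[OF _ lev])
    have "{p \<in> space (borel \<Otimes>\<^sub>M borel \<Otimes>\<^sub>M borel). (fst p)\<^sup>2 < 1 \<longrightarrow> 0 < gram (fst p) (fst (snd p)) (snd (snd p)) \<longrightarrow>
      ((fst p, fst (snd p), snd (snd p)) \<in> S \<longleftrightarrow> (fst p, gram (fst p) (fst (snd p)) (snd (snd p))) \<in> H)}
      \<in> sets (borel \<Otimes>\<^sub>M borel \<Otimes>\<^sub>M borel)" by measurable
    then show "{p. (fst p)\<^sup>2 < 1 \<longrightarrow> 0 < gram (fst p) (fst (snd p)) (snd (snd p)) \<longrightarrow>
      ((fst p, fst (snd p), snd (snd p)) \<in> S \<longleftrightarrow> (fst p, gram (fst p) (fst (snd p)) (snd (snd p))) \<in> H)}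
      \<in> sets borel" unfolding borel_prod by simp
  qed
  \<comment> \<open>Apply the fibre description to (y, x, z) and, with the order of quantifiers
    exchanged, to (x, y, z); the symmetry of \<open>S\<close> and of the Gram value identifies the
    two.\<close>
  have "AE y in lborel. AE x in lborel. AE z in lborel. 0 < gram y x z \<longrightarrow>
      y\<^sup>2 < 1 \<and> x\<^sup>2 < 1 \<longrightarrow> ((y, gram y x z) \<in> H \<longleftrightarrow> (x, gram y x z) \<in> H)"
    using lev lev'
  proof (eventually_elim, goal_cases)
    case (1 y)
    from 1 show ?case
    proof (eventually_elim, goal_cases)
      case (1 x)
      from 1 show ?case
        by eventually_elim (use sym in \<open>auto simp: gram_swap\<close>)
    qed
  qed
  then have ae_y: "AE y in lborel. AE x in lborel. AE d in lborel. 0 < d \<and> d < (1 - y\<^sup>2) * (1 - x\<^sup>2) \<longrightarrow>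
      y\<^sup>2 < 1 \<and> x\<^sup>2 < 1 \<longrightarrow> ((y, d) \<in> H \<longleftrightarrow> (x, d) \<in> H)"
    by (rule eventually_mono) (erule eventually_mono, rule AE_gram_image)
  obtain Y where Y: "\<And>n. AE x in lborel. AE d in lborel. 0 < d \<and> d < (1 - (Y n)\<^sup>2) * (1 - x\<^sup>2) \<longrightarrow>
      (Y n)\<^sup>2 < 1 \<and> x\<^sup>2 < 1 \<longrightarrow> ((Y n, d) \<in> H \<longleftrightarrow> (x, d) \<in> H)" and Y0: "Y \<longlonglongrightarrow> 0"
    using AE_obtain_sequence[OF ae_y] by blast
  \<comment> \<open>For almost every x and d, membership of (Y n, d) in \<open>H\<close> agrees with
    that of (x, d) once Y n is small enough for d to be a common level. Asking for membership
    eventually therefore gives a set of levels independent of x, and Borel by its countable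
    form.\<close>
  define T where "T = {d. \<exists>N. \<forall>n\<ge>N. (Y n, d) \<in> H}"
  have [measurable]: "T \<in> sets borel"
  proof -
    have "{d \<in> space borel. \<exists>N. \<forall>n. n \<ge> N \<longrightarrow> (Y n, d) \<in> H} \<in> sets borel" by measurable
    then show ?thesis by (simp add: T_def)
  qed
  have levT: "AE x in lborel. AE d in lborel. x\<^sup>2 < 1 \<and> 0 < d \<and> d < 1 - x\<^sup>2 \<longrightarrow> ((x, d) \<in> H \<longleftrightarrow> d \<in> T)"
  proof -
    have "AE x in lborel. \<forall>n. AE d in lborel. 0 < d \<and> d < (1 - (Y n)\<^sup>2) * (1 - x\<^sup>2) \<longrightarrow>
      (Y n)\<^sup>2 < 1 \<and> x\<^sup>2 < 1 \<longrightarrow> ((Y n, d) \<in> H \<longleftrightarrow> (x, d) \<in> H)"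
      unfolding AE_all_countable using Y by blast
    then show ?thesis
    proof (rule eventually_mono)
      fix x assume "\<forall>n. AE d in lborel. 0 < d \<and> d < (1 - (Y n)\<^sup>2) * (1 - x\<^sup>2) \<longrightarrow>
        (Y n)\<^sup>2 < 1 \<and> x\<^sup>2 < 1 \<longrightarrow> ((Y n, d) \<in> H \<longleftrightarrow> (x, d) \<in> H)"
      then have "AE d in lborel. \<forall>n. 0 < d \<and> d < (1 - (Y n)\<^sup>2) * (1 - x\<^sup>2) \<longrightarrow>
        (Y n)\<^sup>2 < 1 \<and> x\<^sup>2 < 1 \<longrightarrow> ((Y n, d) \<in> H \<longleftrightarrow> (x, d) \<in> H)"
        unfolding AE_all_countable by blast
      then show "AE d in lborel. x\<^sup>2 < 1 \<and> 0 < d \<and> d < 1 - x\<^sup>2 \<longrightarrow> ((x, d) \<in> H \<longleftrightarrow> d \<in> T)"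
      proof (rule eventually_mono, intro impI)
        fix d assume *: "\<forall>n. 0 < d \<and> d < (1 - (Y n)\<^sup>2) * (1 - x\<^sup>2) \<longrightarrow>
          (Y n)\<^sup>2 < 1 \<and> x\<^sup>2 < 1 \<longrightarrow> ((Y n, d) \<in> H \<longleftrightarrow> (x, d) \<in> H)"
          and d: "x\<^sup>2 < 1 \<and> 0 < d \<and> d < 1 - x\<^sup>2"
        obtain N where N: "\<And>n. n \<ge> N \<Longrightarrow> d < (1 - x\<^sup>2) * (1 - (Y n)\<^sup>2)"
          using eventually_level[OF Y0, of d "1 - x\<^sup>2"] d by (auto simp: eventually_sequentially)
        have "(Y n, d) \<in> H \<longleftrightarrow> (x, d) \<in> H" if "n \<ge> N" for n
        proof -
          have "0 < (1 - x\<^sup>2) * (1 - (Y n)\<^sup>2)" using N[OF that] d by linarith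
          then have "(Y n)\<^sup>2 < 1" using d by (simp add: zero_less_mult_iff)
          then show ?thesis using * N[OF that] d by (auto simp: mult.commute)
        qed
        then have e: "(Y n, d) \<in> H \<longleftrightarrow> (x, d) \<in> H" if "n \<ge> N" for n using that by blast
        show "(x, d) \<in> H \<longleftrightarrow> d \<in> T"
        proof
          assume "(x, d) \<in> H"
          then show "d \<in> T" unfolding T_def using e by blast
        next
          assume "d \<in> T"
          then obtain M where "\<And>n. n \<ge> M \<Longrightarrow> (Y n, d) \<in> H" by (auto simp: T_def)
          then show "(x, d) \<in> H" using e[of "max M N"] by simp
        qed
      qed
    qed
  qed
  have SlT: "AE x in lborel. AE y in lborel. AE z in lborel. x\<^sup>2 < 1 \<longrightarrow> 0 < gram x y z \<longrightarrow>
      ((x, y, z) \<in> S \<longleftrightarrow> gram x y z \<in> T)"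
    using lev levT
  proof (eventually_elim, goal_cases)
    case (1 x)
    show ?case
      using 1(1) AE_lborel_singleton[of 0]
    proof (eventually_elim, goal_cases)
      case (1 y)
      show ?case
        using 1(1) AE_gram_preimage[OF \<open>AE d in lborel. x\<^sup>2 < 1 \<and> 0 < d \<and> d < 1 - x\<^sup>2 \<longrightarrow> ((x, d) \<in> H \<longleftrightarrow> d \<in> T)\<close>, of x y]
        by eventually_elim (use gram_bound[of x y] 1(2) in auto)
    qed
  qed
  have two: "(2::real) \<noteq> 0" by simp
  \<comment> \<open>The description by \<open>T\<close> is used both at (x, y, z) and at (2 x^2 - 1,
    y, 2 x z - y). Pulling it back to the second point is legitimate because x \<mapsto> 2 x^2 - 1
    is quadratic and z \<mapsto> 2 x z - y is affine with nonzero slope for x \<noteq> 0.\<close>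
  have "AE x in lborel. AE y in lborel. AE z in lborel. 0 < gram x y z \<longrightarrow> x\<^sup>2 < 1 \<longrightarrow>
      (4 * x\<^sup>2 * gram x y z \<in> T \<longrightarrow> gram x y z \<in> T)"
    using SlT AE_preimage_quadratic[OF SlT two, of "-1" 0] AE_lborel_singleton[of 0]
  proof (eventually_elim, goal_cases)
    case (1 x)
    note x0 = 1(3)
    have eq: "-1 + 2 * (x - 0)\<^sup>2 = 2 * x\<^sup>2 - 1" by simp
    show ?case
      using 1(1) 1(2)[unfolded eq]
    proof (eventually_elim, goal_cases)
      case (1 y)
      have b: "2 * x \<noteq> 0" using x0 by simp
      show ?case
        using 1(1) AE_preimage_affine[OF 1(2) b, of y]
      proof (eventually_elim, intro impI, goal_cases)
        case (1 z)
        have "1 - (2 * x\<^sup>2 - 1)\<^sup>2 = 4 * x\<^sup>2 * (1 - x\<^sup>2)" by (simp add: power2_eq_square algebra_simps)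
        also have "\<dots> > 0" using x0 1 by simp
        finally have "(2 * x\<^sup>2 - 1)\<^sup>2 < 1" by simp
        moreover have "0 < 4 * x\<^sup>2 * gram x y z" using x0 1 by simp
        ultimately show ?case using 1 double[of x y z] x0 unfolding gram_double by blast
      qed
    qed
  qed
  then have "AE x in lborel. AE y in lborel. AE d in lborel. 0 < d \<and> d < (1 - x\<^sup>2) * (1 - y\<^sup>2) \<longrightarrow>
      x\<^sup>2 < 1 \<longrightarrow> (4 * x\<^sup>2 * d \<in> T \<longrightarrow> d \<in> T)"
    by (rule eventually_mono) (erule eventually_mono, rule AE_gram_image)
  then have "AE x in lborel. AE d in lborel. 0 < d \<and> d < 1 - x\<^sup>2 \<longrightarrow>
      x\<^sup>2 < 1 \<longrightarrow> (4 * x\<^sup>2 * d \<in> T \<longrightarrow> d \<in> T)"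
    by (rule eventually_mono) (rule AE_level_sweep)
  then have "AE x in lborel. AE d in lborel. 0 < d \<and> d < 1 - x\<^sup>2 \<longrightarrow> 4 * x\<^sup>2 * d \<in> T \<longrightarrow> d \<in> T"
    by (elim eventually_mono) auto
  then have dich: "(AE d in lborel. 0 < d \<and> d < 1 \<longrightarrow> d \<notin> T) \<or> (AE d in lborel. 0 < d \<and> d < 1 \<longrightarrow> d \<in> T)"
    by (intro self_improving_set) auto
  have pull: "AE x in lborel. AE y in lborel. AE z in lborel. x\<^sup>2 < 1 \<longrightarrow> 0 < gram x y z \<longrightarrow> ((x, y, z) \<in> S \<longleftrightarrow> b)"
    if "AE d in lborel. 0 < d \<and> d < 1 \<longrightarrow> (d \<in> T \<longleftrightarrow> b)" for b
    using SlT
  proof (eventually_elim, goal_cases)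
    case (1 x)
    show ?case
      using 1 AE_lborel_singleton[of 0]
    proof (eventually_elim, goal_cases)
      case (1 y)
      show ?case
        using 1(1) AE_gram_preimage[OF that, of x y]
      proof (eventually_elim, intro impI, goal_cases)
        case (1 z)
        then have "gram x y z < 1" using gram_bound[of x y z] \<open>y \<noteq> 0\<close> zero_le_power2[of x] by linarith
        then show ?case using 1 by blast
      qed
    qed
  qed
  from dich show ?thesis
  proof
    assume "AE d in lborel. 0 < d \<and> d < 1 \<longrightarrow> d \<notin> T"
    then show ?thesis using pull[of False] by simp
  next
    assume "AE d in lborel. 0 < d \<and> d < 1 \<longrightarrow> d \<in> T"
    then show ?thesis using pull[of True] by simp
  qed
qed

section \<open>SU(2) as unit quaternions\<close>

text \<open>The complex matrix of the quaternion z + w j. No norm condition is imposed, so that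
  products and adjoints can be computed before restricting to unit length.\<close>

definition quat :: "complex \<Rightarrow> complex \<Rightarrow> complex^2^2" where
  "quat z w = (\<chi> i j. if i = 1 then (if j = 1 then z else w) else (if j = 1 then - cnj w else cnj z))"

text \<open>On matrices of the form \<open>quat z w\<close> this is the real part of the quaternion,
  that is, half the trace.\<close>

definition qre :: "complex^2^2 \<Rightarrow> real" where
  "qre A = Re (A $ 1 $ 1)"

lemma quat_nth [simp]:
  "quat z w $ 1 $ 1 = z" "quat z w $ 1 $ 2 = w" "quat z w $ 2 $ 1 = - cnj w" "quat z w $ 2 $ 2 = cnj z"
  by (simp_all add: quat_def)

lemma mat2_eq_iff:
  "(A :: complex^2^2) = B \<longleftrightarrow> A $ 1 $ 1 = B $ 1 $ 1 \<and> A $ 1 $ 2 = B $ 1 $ 2 \<and> A $ 2 $ 1 = B $ 2 $ 1 \<and> A $ 2 $ 2 = B $ 2 $ 2"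
  by (auto simp: vec_eq_iff forall_2)

lemma quat_eq_iff [simp]: "quat z w = quat z' w' \<longleftrightarrow> z = z' \<and> w = w'"
  by (auto simp: mat2_eq_iff)

lemma quat_mult: "quat z w ** quat z' w' = quat (z * z' - w * cnj w') (z * w' + w * cnj z')"
  by (simp add: mat2_eq_iff matrix_matrix_mult_def sum_2 algebra_simps)

lemma cadj_quat: "cadj (quat z w) = quat (cnj z) (- w)"
  by (simp add: mat2_eq_iff cadj_def)

lemma mat_1_quat: "mat 1 = quat 1 0"
  by (simp add: mat2_eq_iff mat_def)

lemma det_quat: "det (quat z w) = z * cnj z + w * cnj w"
  by (simp add: det_2)

lemma quat_in_SU2_iff: "quat z w \<in> SU2 \<longleftrightarrow> (cmod z)\<^sup>2 + (cmod w)\<^sup>2 = 1"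
proof -
  have e: "z * cnj z + w * cnj w = complex_of_real ((cmod z)\<^sup>2 + (cmod w)\<^sup>2)"
    by (simp only: complex_norm_square of_real_add)
  have "quat z w \<in> SU2 \<longleftrightarrow> z * cnj z + w * cnj w = 1"
    by (auto simp: SU2_def cadj_quat quat_mult mat_1_quat det_quat algebra_simps)
  then show ?thesis unfolding e of_real_eq_1_iff .
qed

lemma SU2_quat:
  assumes "A \<in> SU2"
  obtains z w where "A = quat z w" "(cmod z)\<^sup>2 + (cmod w)\<^sup>2 = 1"
proof -
  define p q r s where "p = A $ 1 $ 1" "q = A $ 1 $ 2" "r = A $ 2 $ 1" "s = A $ 2 $ 2"
  have A: "cadj A ** A = mat 1" "det A = 1" using assms by (auto simp: SU2_def)
  have e: "cnj p * p + cnj r * r = 1" "cnj p * q + cnj r * s = 0" "cnj q * q + cnj s * s = 1" "p * s - q * r = 1"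
    using A by (simp_all add: mat2_eq_iff matrix_matrix_mult_def sum_2 cadj_def mat_def det_2 p_q_r_s_def)
  have s: "s = cnj p"
  proof -
    \<comment> \<open>Inserting the unit length of the first column lets the right side be regrouped
      into the determinant and the orthogonality of the columns.\<close>
    have "s = (cnj p * p + cnj r * r) * s" using e by simp
    also have "\<dots> = cnj p * (p * s - q * r) + r * (cnj p * q + cnj r * s)" by (simp add: algebra_simps)
    finally show ?thesis using e by simp
  qed
  have q: "q = - cnj r"
  proof -
    have "q = (cnj p * p + cnj r * r) * q" using e by simp
    also have "\<dots> = - cnj r * (p * s - q * r) + p * (cnj p * q + cnj r * s)" by (simp add: algebra_simps)
    finally show ?thesis using e by simp
  qed
  have "A = quat p q" using s q by (simp add: mat2_eq_iff p_q_r_s_def)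
  with that assms show ?thesis using quat_in_SU2_iff by blast
qed

lemma mat_1_SU2 [simp]: "mat 1 \<in> SU2"
  by (simp add: mat_1_quat quat_in_SU2_iff)

lemma cadj_cadj [simp]: "cadj (cadj A) = A"
  by (simp add: cadj_def vec_eq_iff)

lemma cadj_mult: "cadj (A ** B) = cadj B ** cadj A"
  by (simp add: mat2_eq_iff cadj_def matrix_matrix_mult_def sum_2 algebra_simps)

lemma cadj_SU2 [simp]: "A \<in> SU2 \<Longrightarrow> cadj A \<in> SU2"
  by (erule SU2_quat) (simp add: cadj_quat quat_in_SU2_iff)

lemma cadj_mult_SU2 [simp]:
  assumes "A \<in> SU2"
  shows "cadj A ** A = mat 1" "A ** cadj A = mat 1"
  using assms cadj_SU2[OF assms] by (auto simp: SU2_def)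

lemma mult_SU2 [simp]:
  assumes "A \<in> SU2" "B \<in> SU2"
  shows "A ** B \<in> SU2"
proof -
  have "cadj (A ** B) ** (A ** B) = cadj B ** (cadj A ** A) ** B"
    by (simp only: cadj_mult matrix_mul_assoc)
  also have "\<dots> = mat 1"
    by (simp only: cadj_mult_SU2(1)[OF assms(1)] cadj_mult_SU2(1)[OF assms(2)] matrix_mul_rid)
  finally have "cadj (A ** B) ** (A ** B) = mat 1" .
  moreover have "det (A ** B) = 1" using assms unfolding SU2_def det_mul by simp
  ultimately show ?thesis unfolding SU2_def by simp
qed

lemma SU2_cancel:
  assumes "A \<in> SU2"
  shows "cadj A ** (A ** B) = B" "A ** (cadj A ** B) = B" "B ** A ** cadj A = B" "B ** cadj A ** A = B"
  using assms by (simp_all add: matrix_mul_assoc) (simp_all flip: matrix_mul_assoc)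

lemma qre_quat [simp]: "qre (quat z w) = Re z"
  by (simp add: qre_def)

lemma qre_mult_commute:
  assumes "A \<in> SU2" "B \<in> SU2"
  shows "qre (A ** B) = qre (B ** A)"
  using assms by (elim SU2_quat) (simp add: quat_mult)

lemma qre_conj:
  assumes "A \<in> SU2" "g \<in> SU2"
  shows "qre (g ** A ** cadj g) = qre A"
  using assms qre_mult_commute[of "g ** A" "cadj g"] by (simp add: SU2_cancel)

text \<open>The Cayley-Hamilton relation A^2 = 2 (Re A) A - 1, multiplied by B. It is the origin of
  the trace map (y, z) \<mapsto> (z, 2 x z - y).\<close>

lemma qre_square_mult:
  assumes "A \<in> SU2" "B \<in> SU2"
  shows "qre (A ** (A ** B)) = 2 * qre A * qre (A ** B) - qre B"
proof -
  obtain z w where A: "A = quat z w" and n: "(cmod z)\<^sup>2 + (cmod w)\<^sup>2 = 1" using assms by (elim SU2_quat)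
  obtain u v where B: "B = quat u v" using assms by (elim SU2_quat)
  have n': "(Im z)\<^sup>2 + (Re w)\<^sup>2 + (Im w)\<^sup>2 = 1 - (Re z)\<^sup>2"
    using n by (simp add: cmod_power2)
  have "qre (A ** (A ** B)) - 2 * qre A * qre (A ** B) = - (Re u * ((Re z)\<^sup>2 + ((Im z)\<^sup>2 + (Re w)\<^sup>2 + (Im w)\<^sup>2)))"
    by (simp add: A B quat_mult power2_eq_square algebra_simps)
  then show ?thesis unfolding n' by (simp add: B)
qed

lemma qre_square:
  assumes "A \<in> SU2"
  shows "qre (A ** A) = 2 * (qre A)\<^sup>2 - 1"
proof -
  have "qre (mat 1) = 1" by (simp add: mat_1_quat)
  then show ?thesis using qre_square_mult[OF assms mat_1_SU2] by (simp add: power2_eq_square)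
qed

lemma qre_le_1:
  assumes "A \<in> SU2"
  shows "(qre A)\<^sup>2 \<le> 1"
proof -
  obtain z w where A: "A = quat z w" "(cmod z)\<^sup>2 + (cmod w)\<^sup>2 = 1" using assms by (rule SU2_quat)
  then have "(Re z)\<^sup>2 \<le> 1" by (simp add: cmod_power2) (smt (verit) zero_le_power2)
  then show ?thesis by (simp add: A)
qed

section \<open>Normal forms of pairs under conjugation\<close>

definition diag_form :: "real \<Rightarrow> complex^2^2" where
  "diag_form x = quat (Complex x (sqrt (1 - x\<^sup>2))) 0"

text \<open>The upper left entry of b once a is diagonal. Its real part is y, and its imaginary part
  v is solved from z = x y - sqrt (1 - x^2) v.\<close>

definition rel_coord :: "real \<Rightarrow> real \<Rightarrow> real \<Rightarrow> complex" where
  "rel_coord x y z = Complex y ((x * y - z) / sqrt (1 - x\<^sup>2))"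

text \<open>Conjugation by diagonal matrices fixes \<open>diag_form x\<close> and rotates the phase
  of the off-diagonal entry of b, which can thus be normalised to a nonnegative real; unit length
  then determines it.\<close>

definition rel_form :: "real \<Rightarrow> real \<Rightarrow> real \<Rightarrow> complex^2^2" where
  "rel_form x y z = quat (rel_coord x y z) (of_real (sqrt (1 - (cmod (rel_coord x y z))\<^sup>2)))"

lemma diag_form_SU2: "x\<^sup>2 \<le> 1 \<Longrightarrow> diag_form x \<in> SU2"
  by (simp add: diag_form_def quat_in_SU2_iff cmod_power2)

lemma rel_coord_norm:
  assumes "x\<^sup>2 < 1"
  shows "1 - (cmod (rel_coord x y z))\<^sup>2 = gram x y z / (1 - x\<^sup>2)"
proof -
  have "(cmod (rel_coord x y z))\<^sup>2 = y\<^sup>2 + (x * y - z)\<^sup>2 / (1 - x\<^sup>2)"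
    using assms by (simp add: rel_coord_def cmod_power2 power_divide)
  then show ?thesis using assms
    by (simp add: gram_eq field_simps) (simp add: power2_eq_square algebra_simps)
qed

lemma rel_form_SU2:
  assumes "x\<^sup>2 < 1" "0 \<le> gram x y z"
  shows "rel_form x y z \<in> SU2"
proof -
  have "0 \<le> 1 - (cmod (rel_coord x y z))\<^sup>2" using assms by (simp add: rel_coord_norm)
  then show ?thesis by (simp add: rel_form_def quat_in_SU2_iff)
qed

lemma qre_forms:
  assumes "x\<^sup>2 < 1"
  shows "qre (diag_form x) = x" "qre (rel_form x y z) = y" "qre (diag_form x ** rel_form x y z) = z"
proof -
  have "sqrt (1 - x\<^sup>2) \<noteq> 0" using assms by simp
  then show "qre (diag_form x ** rel_form x y z) = z"
    by (simp add: diag_form_def rel_form_def quat_mult rel_coord_def)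
qed (simp_all add: diag_form_def rel_form_def rel_coord_def)

lemma SU2_diagonalize:
  assumes "a \<in> SU2"
  obtains g where "g \<in> SU2" "a = g ** diag_form (qre a) ** cadj g"
proof -
  obtain p w where a: "a = quat p w" and n: "(cmod p)\<^sup>2 + (cmod w)\<^sup>2 = 1" using assms by (rule SU2_quat)
  define x t s where "x = Re p" "t = Im p" "s = sqrt (1 - x\<^sup>2)"
  have n': "t\<^sup>2 + (cmod w)\<^sup>2 = 1 - x\<^sup>2" using n by (simp add: cmod_power2 x_t_s_def)
  then have "0 \<le> 1 - x\<^sup>2" by (metis add_nonneg_nonneg zero_le_power2)
  then have s2: "s\<^sup>2 = t\<^sup>2 + (cmod w)\<^sup>2" and s0: "0 \<le> s" using n' by (auto simp: x_t_s_def)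
  have p: "p = Complex x t" by (simp add: x_t_s_def)
  have d: "diag_form (qre a) = quat (Complex x s) 0" by (simp add: diag_form_def a x_t_s_def)
  show ?thesis
  proof (cases "w = 0 \<and> t = s")
    case True
    then have "a = mat 1 ** diag_form (qre a) ** cadj (mat 1)"
      by (simp add: d) (simp add: a p mat_1_quat cadj_quat quat_mult)
    then show ?thesis using that mat_1_SU2 by blast
  next
    case False
    define l where "l = sqrt ((cmod w)\<^sup>2 + (s - t)\<^sup>2)"
    have "(cmod w)\<^sup>2 + (s - t)\<^sup>2 > 0"
      using False by (auto simp: sum_power2_gt_zero_iff)
    then have l: "l > 0" "l\<^sup>2 = (cmod w)\<^sup>2 + (s - t)\<^sup>2" by (auto simp: l_def)
    \<comment> \<open>The first column is a unit eigenvector of a for the eigenvalue x + i s. Before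
      division by l it vanishes only if w = 0 and t = s, the case where a is already in diagonal
      form.\<close>
    define g where "g = quat (w / of_real l) (\<i> * of_real ((s - t) / l))"
    have g: "g \<in> SU2"
    proof -
      have m: "cmod (\<i> * complex_of_real ((s - t) / l)) = \<bar>(s - t) / l\<bar>"
        by (simp only: norm_mult norm_ii norm_of_real mult_1_left)
      have "(cmod w)\<^sup>2 / l\<^sup>2 + (s - t)\<^sup>2 / l\<^sup>2 = 1"
        unfolding add_divide_distrib[symmetric] l(2)[symmetric] using l(1) by simp
      then show ?thesis
        unfolding g_def quat_in_SU2_iff m using l(1) by (simp add: norm_divide power_divide)
    qed
    have ww: "w * cnj w = of_real (s\<^sup>2 - t\<^sup>2)" using s2 by (simp only: complex_norm_square[symmetric]) simp
    have "a ** g = g ** diag_form (qre a)"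
    proof -
      have 1: "p * (w / of_real l) - w * cnj (\<i> * of_real ((s - t) / l)) = w / of_real l * Complex x s"
        using l(1) by (simp add: p complex_eq_iff field_simps)
      have 2: "p * (\<i> * of_real ((s - t) / l)) + w * cnj (w / of_real l) = \<i> * of_real ((s - t) / l) * cnj (Complex x s)"
      proof -
        have "w * cnj (w / of_real l) = of_real (s\<^sup>2 - t\<^sup>2) / of_real l" by (simp add: ww)
        then show ?thesis using l(1) by (simp add: p complex_eq_iff field_simps power2_eq_square)
      qed
      show ?thesis unfolding d unfolding a g_def quat_mult using 1 2 by simp
    qed
    then have "a = g ** diag_form (qre a) ** cadj g"
      using g by (metis SU2_cancel(3))
    then show ?thesis using that g by blast
  qed
qed

text \<open>Conjugation by \<open>quat c 0\<close> multiplies the off-diagonal entry w by c^2, so a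
  square root of the inverse phase of w is required.\<close>

lemma SU2_phase:
  obtains c where "cmod c = 1" "c * c * w = of_real (cmod w)"
proof (cases "w = 0")
  case True
  then show ?thesis using that[of 1] by simp
next
  case False
  define c where "c = cis (- Arg w / 2)"
  have "c * c = cis (- Arg w)" by (simp add: c_def cis_mult)
  moreover have "w = of_real (cmod w) * cis (Arg w)"
    using rcis_cmod_Arg[of w] by (simp add: rcis_def)
  ultimately have "c * c * w = cis (- Arg w) * (of_real (cmod w) * cis (Arg w))" by simp
  also have "\<dots> = of_real (cmod w) * (cis (- Arg w) * cis (Arg w))" by (simp only: mult.left_commute)
  finally show ?thesis using that[of c] by (simp add: c_def cis_mult)
qed

text \<open>Diagonalise a by \<open>h\<close>, then use the remaining diagonal matrices
  \<open>k\<close> to make the off-diagonal entry of b real and nonnegative. Since a is not central,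
  the traces of b and a b recover the two real coordinates of the diagonal entry, and nothing else
  is left free.\<close>

lemma SU2_pair_normal_form:
  assumes a: "a \<in> SU2" and b: "b \<in> SU2" and x: "(qre a)\<^sup>2 < 1"
  obtains g where "g \<in> SU2" "g ** a ** cadj g = diag_form (qre a)"
    "g ** b ** cadj g = rel_form (qre a) (qre b) (qre (a ** b))"
proof -
  define x where "x = qre a"
  obtain h where h: "h \<in> SU2" "a = h ** diag_form x ** cadj h"
    unfolding x_def by (rule SU2_diagonalize[OF a])
  define b' where "b' = cadj h ** b ** h"
  have b': "b' \<in> SU2" unfolding b'_def using h b by simp
  then obtain z w where zw: "b' = quat z w" "(cmod z)\<^sup>2 + (cmod w)\<^sup>2 = 1" by (rule SU2_quat)
  obtain c where c: "cmod c = 1" "c * c * w = of_real (cmod w)" by (rule SU2_phase)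
  have cc: "c * cnj c = 1" using c(1) by (simp add: complex_norm_square[symmetric])
  define k where "k = quat c 0"
  have k: "k \<in> SU2" using c by (simp add: k_def quat_in_SU2_iff)
  define g where "g = k ** cadj h"
  have g: "g \<in> SU2" unfolding g_def using k h by simp
  have cg: "cadj g = h ** cadj k" by (simp add: g_def cadj_mult)
  have "cadj h ** a ** h = diag_form x" using h by (simp add: SU2_cancel flip: matrix_mul_assoc)
  then have ga: "g ** a ** cadj g = diag_form x"
  proof -
    assume e: "cadj h ** a ** h = diag_form x"
    have "g ** a ** cadj g = k ** (cadj h ** a ** h) ** cadj k" by (simp add: g_def cadj_mult matrix_mul_assoc)
    also have "\<dots> = diag_form x" unfolding e using cc
      by (simp add: k_def diag_form_def cadj_quat quat_mult mult.commute mult.left_commute)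
    finally show ?thesis .
  qed
  have gb: "g ** b ** cadj g = quat z (of_real (cmod w))"
  proof -
    have "g ** b ** cadj g = k ** b' ** cadj k" by (simp add: g_def b'_def cadj_mult matrix_mul_assoc)
    also have "\<dots> = quat z (of_real (cmod w))" using cc c(2)
      by (simp add: zw k_def cadj_quat quat_mult mult.commute mult.left_commute)
    finally show ?thesis .
  qed
  have rz: "Re z = qre b" using qre_conj[OF b g] unfolding gb by simp
  have "qre (a ** b) = qre (g ** (a ** b) ** cadj g)" using qre_conj[of "a ** b" g] a b g by simp
  also have "g ** (a ** b) ** cadj g = (g ** a ** cadj g) ** (g ** b ** cadj g)"
    using g by (simp add: matrix_mul_assoc SU2_cancel)
  also have "qre \<dots> = x * Re z - sqrt (1 - x\<^sup>2) * Im z"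
    unfolding ga gb by (simp add: diag_form_def quat_mult)
  finally have e: "qre (a ** b) = x * Re z - sqrt (1 - x\<^sup>2) * Im z" .
  have "sqrt (1 - x\<^sup>2) \<noteq> 0" using x by (simp add: x_def)
  then have "z = rel_coord x (qre b) (qre (a ** b))"
    unfolding e rel_coord_def by (simp add: complex_eq_iff rz)
  moreover have "cmod w = sqrt (1 - (cmod z)\<^sup>2)" 
    by (rule real_sqrt_unique[symmetric]) (use zw(2) in simp_all)
  ultimately have "g ** b ** cadj g = rel_form x (qre b) (qre (a ** b))"
    unfolding gb rel_form_def by simp
  then show ?thesis using that g ga unfolding x_def by blast
qed

section \<open>The Haar measure in trace coordinates\<close>

lemma continuous_on_matrix_mult [continuous_intros]:
  fixes f g :: "'a::topological_space \<Rightarrow> complex^2^2"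
  assumes "continuous_on S f" "continuous_on S g"
  shows "continuous_on S (\<lambda>x. f x ** g x)"
  unfolding matrix_matrix_mult_def by (intro continuous_intros assms)

lemma continuous_on_cadj [continuous_intros]:
  assumes "continuous_on S f"
  shows "continuous_on S (\<lambda>x. cadj (f x))"
  unfolding cadj_def by (intro continuous_intros assms)

lemma continuous_on_qre [continuous_intros]:
  assumes "continuous_on S f"
  shows "continuous_on S (\<lambda>x. qre (f x))"
  unfolding qre_def by (intro continuous_intros assms)

lemma matrix_mult_measurable [measurable]:
  fixes f g :: "'a \<Rightarrow> complex^2^2"
  assumes [measurable]: "f \<in> borel_measurable M" "g \<in> borel_measurable M"
  shows "(\<lambda>x. f x ** g x) \<in> borel_measurable M"
proof -
  have "(\<lambda>p::(complex^2^2) \<times> (complex^2^2). fst p ** snd p) \<in> borel_measurable borel"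
    by (intro borel_measurable_continuous_onI continuous_intros)
  then have "(\<lambda>p::(complex^2^2) \<times> (complex^2^2). fst p ** snd p) \<in> borel_measurable (borel \<Otimes>\<^sub>M borel)"
    unfolding borel_prod .
  from measurable_compose[OF measurable_Pair[OF assms] this] show ?thesis by (simp only: fst_conv snd_conv)
qed

lemma qre_measurable [measurable]:
  assumes "f \<in> borel_measurable M"
  shows "(\<lambda>x. qre (f x)) \<in> borel_measurable M"
  by (rule measurable_compose[OF assms borel_measurable_continuous_onI]) (intro continuous_intros)

lemma quat_measurable [measurable]:
  assumes [measurable]: "f \<in> borel_measurable M" "g \<in> borel_measurable M"
  shows "(\<lambda>x. quat (f x) (g x)) \<in> borel_measurable M"
proof -
  have c: "continuous_on UNIV (\<lambda>p::complex \<times> complex. quat (fst p) (snd p))"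
    unfolding quat_def
  proof (intro continuous_on_vec_lambda)
    show "continuous_on UNIV (\<lambda>x::complex \<times> complex. if i = 1 then if j = 1 then fst x else snd x
        else if j = 1 then - cnj (snd x) else cnj (fst x))" for i j :: 2
      by (cases "i = 1"; cases "j = 1") (auto intro!: continuous_intros)
  qed
  have "(\<lambda>p::complex \<times> complex. quat (fst p) (snd p)) \<in> borel_measurable (borel \<Otimes>\<^sub>M borel)"
    unfolding borel_prod by (intro borel_measurable_continuous_onI c)
  from measurable_compose[OF measurable_Pair[OF assms] this] show ?thesis by (simp only: fst_conv snd_conv)
qed

lemma closed_SU2: "closed SU2"
proof -
  have eq: "SU2 = {A. cadj A ** A = mat 1} \<inter> {A. A $ 1 $ 1 * A $ 2 $ 2 - A $ 1 $ 2 * A $ 2 $ 1 = 1}"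
    unfolding SU2_def det_2 by blast
  show ?thesis
    unfolding eq by (intro closed_Int closed_Collect_eq continuous_intros)
qed

lemma haar_space:
  assumes "is_haar_SU2 M"
  shows "space M = SU2" "sets M = sets (restrict_space borel SU2)" "prob_space M"
  using assms sets_eq_imp_space_eq[of M "restrict_space borel SU2"]
  by (auto simp: is_haar_SU2_def space_restrict_space)

lemma haar_borel:
  assumes "is_haar_SU2 M"
  shows "f \<in> borel_measurable borel \<Longrightarrow> f \<in> borel_measurable M" "A \<in> sets borel \<Longrightarrow> A \<inter> SU2 \<in> sets M"
proof -
  show "f \<in> borel_measurable M" if "f \<in> borel_measurable borel"
    unfolding measurable_cong_sets[OF haar_space(2)[OF assms] refl]
    using that by (rule measurable_restrict_space1)
  show "A \<inter> SU2 \<in> sets M" if "A \<in> sets borel"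
    unfolding haar_space(2)[OF assms] sets_restrict_space using that by blast
qed

lemma haar_invariant:
  assumes h: "is_haar_SU2 M" and g: "g \<in> SU2" and B: "B \<in> sets borel"
    and ae: "AE b in M. g ** b \<notin> B"
  shows "AE b in M. b \<notin> B"
proof -
  note [measurable] = B
  have sB: "B \<inter> SU2 \<in> sets M" by (rule haar_borel(2)[OF h B])
  have "(\<lambda>b :: complex^2^2. g ** b) \<in> borel_measurable borel"
    by (rule borel_measurable_continuous_onI continuous_on_matrix_mult continuous_on_const continuous_on_id)+
  then have "(\<lambda>b. g ** b) -` B \<in> sets borel"
    using measurable_sets_borel B by blast
  then have "(\<lambda>b. g ** b) -` B \<inter> SU2 \<in> sets M" by (rule haar_borel(2)[OF h])
  moreover have "(\<lambda>b. g ** b) -` B \<inter> SU2 = (\<lambda>b. g ** b) -` (B \<inter> SU2) \<inter> SU2"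
    using mult_SU2[OF g] by blast
  moreover have "emeasure M ((\<lambda>b. g ** b) -` (B \<inter> SU2) \<inter> SU2) = emeasure M (B \<inter> SU2)"
    using h g sB unfolding is_haar_SU2_def by blast
  moreover have "emeasure M ((\<lambda>b. g ** b) -` B \<inter> SU2) = 0"
  proof (rule iffD1[OF AE_iff_measurable[OF calculation(1)] ae])
    show "{b \<in> space M. \<not> g ** b \<notin> B} = (\<lambda>b. g ** b) -` B \<inter> SU2"
      unfolding haar_space(1)[OF h] by blast
  qed
  ultimately have "B \<inter> SU2 \<in> null_sets M" using sB by (intro null_setsI) metis+
  from AE_not_in[OF this] AE_space show ?thesis
    by eventually_elim (simp add: haar_space(1)[OF h])
qed

text \<open>Left invariance lets the translation be averaged over any measure, here Lebesgue measure on
  quaternions, so that null sets of Lebesgue measure control null sets of Haar measure.\<close>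

lemma haar_null_by_averaging:
  fixes k :: "'k::euclidean_space \<Rightarrow> complex^2^2"
  assumes h: "is_haar_SU2 M" and k [measurable]: "k \<in> borel_measurable borel"
    and kS: "\<And>p. k p \<in> SU2" and B [measurable]: "B \<in> sets borel"
    and ae: "\<And>b. b \<in> SU2 \<Longrightarrow> AE p in lborel. k p ** b \<notin> B"
  shows "AE b in M. b \<notin> B"
proof -
  interpret M: prob_space M using haar_space[OF h] by simp
  interpret P: pair_sigma_finite M "lborel :: 'k measure" ..
  have [measurable]: "(\<lambda>x. x) \<in> borel_measurable M" by (rule haar_borel(1)[OF h]) simp
  have "AE b in M. AE p in lborel. k p ** b \<notin> B"
    using AE_space[of M] by eventually_elim (simp add: ae haar_space[OF h])
  then have "AE p in lborel. AE b in M. k p ** b \<notin> B"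
  proof (rule iffD1[OF P.AE_commute, rotated])
    have [measurable]: "fst \<in> borel_measurable (M \<Otimes>\<^sub>M lborel)"
      using measurable_compose[OF measurable_fst \<open>(\<lambda>x. x) \<in> borel_measurable M\<close>] by (simp add: comp_def)
    show "{x \<in> space (M \<Otimes>\<^sub>M lborel). k (snd x) ** fst x \<notin> B} \<in> sets (M \<Otimes>\<^sub>M lborel)"
      by measurable
  qed
  \<comment> \<open>One good p suffices, because invariance removes the translation by
    \<open>k p\<close>.\<close>
  then have "\<not> {p. \<not> (AE b in M. k p ** b \<notin> B)} = UNIV"
    by (auto simp: AE_lborel_iff_negligible)
  then obtain p where "AE b in M. k p ** b \<notin> B" by blast
  then show ?thesis by (rule haar_invariant[OF h kS B])
qed

section \<open>Lebesgue measure on quaternions projected to the unit sphere\<close>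

text \<open>Radial projection to the unit sphere; the default \<open>mat 1\<close> at the origin
  keeps all values in \<open>SU2\<close>, as the averaging requires.\<close>

definition unit_quat :: "complex \<times> complex \<Rightarrow> complex^2^2" where
  "unit_quat p = (if p = 0 then mat 1 else quat (fst p / norm p) (snd p / norm p))"

lemma unit_quat_SU2: "unit_quat p \<in> SU2"
proof (cases "p = 0")
  case False
  then have "(cmod (fst p / norm p))\<^sup>2 + (cmod (snd p / norm p))\<^sup>2 = (norm p)\<^sup>2 / (norm p)\<^sup>2"
    by (simp add: norm_divide power_divide norm_prod_def flip: add_divide_distrib)
  then show ?thesis using False by (simp add: unit_quat_def quat_in_SU2_iff)
qed (simp add: unit_quat_def)

lemma unit_quat_measurable: "unit_quat \<in> borel_measurable borel"
proof -
  have [measurable]: "fst \<in> borel_measurable (borel :: (complex \<times> complex) measure)"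
    "snd \<in> borel_measurable (borel :: (complex \<times> complex) measure)"
    by (intro borel_measurable_continuous_onI continuous_intros)+
  show ?thesis unfolding unit_quat_def by measurable
qed

text \<open>Left quaternion multiplication written on pairs of complex numbers. It is real linear,
  and for unit (u, v) isometric, so it commutes with the radial projection.\<close>

definition lmul :: "complex \<Rightarrow> complex \<Rightarrow> complex \<times> complex \<Rightarrow> complex \<times> complex" where
  "lmul u v p = (u * fst p - v * cnj (snd p), u * snd p + v * cnj (fst p))"

definition rmul :: "complex \<Rightarrow> complex \<Rightarrow> complex \<times> complex \<Rightarrow> complex \<times> complex" where
  "rmul u v p = (fst p * u - snd p * cnj v, fst p * v + snd p * cnj u)"

lemma linear_lmul: "linear (lmul u v)"
  by (rule linearI) (auto simp: lmul_def algebra_simps)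

lemma linear_rmul: "linear (rmul u v)"
  by (rule linearI) (auto simp: rmul_def algebra_simps)

text \<open>Multiplicativity of the quaternion norm, which is Euler's four-square identity.\<close>

lemma norm_quat_mult:
  "(cmod (z * z' - w * cnj w'))\<^sup>2 + (cmod (z * w' + w * cnj z'))\<^sup>2 = ((cmod z)\<^sup>2 + (cmod w)\<^sup>2) * ((cmod z')\<^sup>2 + (cmod w')\<^sup>2)"
proof -
  have "complex_of_real ((cmod (z * z' - w * cnj w'))\<^sup>2 + (cmod (z * w' + w * cnj z'))\<^sup>2)
    = of_real (((cmod z)\<^sup>2 + (cmod w)\<^sup>2) * ((cmod z')\<^sup>2 + (cmod w')\<^sup>2))"
    unfolding of_real_add of_real_mult complex_norm_square by (simp add: algebra_simps)
  then show ?thesis by (simp only: of_real_eq_iff)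
qed

lemma norm_lmul: "(cmod u)\<^sup>2 + (cmod v)\<^sup>2 = 1 \<Longrightarrow> norm (lmul u v p) = norm p"
  by (simp add: lmul_def norm_prod_def norm_quat_mult)

lemma norm_rmul: "(cmod u)\<^sup>2 + (cmod v)\<^sup>2 = 1 \<Longrightarrow> norm (rmul u v p) = norm p"
  by (simp add: rmul_def norm_prod_def norm_quat_mult)

lemma unit_quat_lmul:
  assumes "(cmod u)\<^sup>2 + (cmod v)\<^sup>2 = 1" "p \<noteq> 0"
  shows "quat u v ** unit_quat p = unit_quat (lmul u v p)"
proof -
  have "lmul u v p \<noteq> 0" using norm_lmul[OF assms(1), of p] assms(2) by auto
  then show ?thesis using assms
    by (simp add: unit_quat_def norm_lmul) (simp add: lmul_def quat_mult add_divide_distrib diff_divide_distrib)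
qed

lemma unit_quat_rmul:
  assumes "(cmod u)\<^sup>2 + (cmod v)\<^sup>2 = 1" "p \<noteq> 0"
  shows "unit_quat p ** quat u v = unit_quat (rmul u v p)"
proof -
  have "rmul u v p \<noteq> 0" using norm_rmul[OF assms(1), of p] assms(2) by auto
  then show ?thesis using assms
    by (simp add: unit_quat_def norm_rmul) (simp add: rmul_def quat_mult add_divide_distrib diff_divide_distrib)
qed

lemma AE_linear_preimage:
  fixes f :: "'a::euclidean_space \<Rightarrow> 'a"
  assumes ae: "AE p in lborel. P p" and g: "linear g" and gf: "\<And>p. g (f p) = p"
  shows "AE p in lborel. P (f p)"
proof -
  have "negligible (g ` {p. \<not> P p})"
    by (rule negligible_differentiable_image_negligible[OF order_refl])
      (use ae g in \<open>auto simp: AE_lborel_iff_negligible linear_imp_differentiable_on\<close>)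
  then have "negligible {p. \<not> P (f p)}"
    by (rule negligible_subset) (auto simp: image_iff gf intro!: exI[of _ "f _"])
  then show ?thesis by (simp add: AE_lborel_iff_negligible)
qed

text \<open>For x^2 < 1 the real linear map c \<mapsto> (Re c, Re (e c)) with e = x + i sqrt (1 -
  x^2) is invertible, because e is not real; \<open>f\<close> is its inverse.\<close>

lemma AE_rel_coord:
  assumes N: "N \<in> null_sets lborel" and x: "x\<^sup>2 < 1"
  shows "AE c in lborel. (Re c, Re (Complex x (sqrt (1 - x\<^sup>2)) * c)) \<notin> N"
proof -
  have s: "sqrt (1 - x\<^sup>2) \<noteq> 0" using x by simp
  define f where "f p = complex_of_real (fst p) + \<i> * complex_of_real ((x * fst p - snd p) / sqrt (1 - x\<^sup>2))" for p :: "real \<times> real"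
  have f: "f (Re c, Re (Complex x (sqrt (1 - x\<^sup>2)) * c)) = c" for c
    using s by (simp add: f_def complex_eq_iff)
  have "negligible N"
    using N by (simp add: negligible_iff_null_sets null_sets_completionI)
  moreover have "f differentiable_on N"
  proof (rule linear_imp_differentiable_on, rule linearI)
    show "f (p + q) = f p + f q" for p q
      by (simp add: f_def complex_eq_iff algebra_simps flip: add_divide_distrib)
    show "f (r *\<^sub>R p) = r *\<^sub>R f p" for r p
      using s by (simp add: f_def complex_eq_iff field_simps)
  qed
  ultimately have "negligible (f ` N)"
    by (intro negligible_differentiable_image_negligible) auto
  then have "negligible {c. \<not> (Re c, Re (Complex x (sqrt (1 - x\<^sup>2)) * c)) \<notin> N}"
  proof (rule negligible_subset, intro subsetI)
    fix c assume "c \<in> {c. \<not> (Re c, Re (Complex x (sqrt (1 - x\<^sup>2)) * c)) \<notin> N}"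
    then show "c \<in> f ` N" using f[of c] by (intro image_eqI[of _ _ "(Re c, Re (Complex x (sqrt (1 - x\<^sup>2)) * c))"]) auto
  qed
  then show ?thesis by (simp only: AE_lborel_iff_negligible)
qed

text \<open>For fixed w \<noteq> 0, the point c = z / |(z, w)| lies in the open unit disc and z =
  |w| c / sqrt (1 - |c|^2) depends differentiably on it. So null sets of c pull back to null sets of
  z, and Fubini treats w.\<close>

lemma AE_first_coord:
  assumes N: "N \<in> sets borel" and ae: "AE c in lborel. c \<notin> N"
  shows "AE p in lborel. fst p / norm (p :: complex \<times> complex) \<notin> N"
proof -
  note [measurable] = N
  have fibre: "AE z in lborel. z / complex_of_real (norm (z, w)) \<notin> N" if w: "w \<noteq> 0" for w :: complex
  proof -
    let ?B = "{c. c \<in> N \<and> norm c < 1}"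
    define f where "f c = (cmod w / sqrt (1 - c \<bullet> c)) *\<^sub>R c" for c :: complex
    have "negligible ?B"
      by (rule negligible_subset[of "{c. \<not> c \<notin> N}"]) (use ae in \<open>auto simp: AE_lborel_iff_negligible\<close>)
    moreover have "f differentiable_on ?B"
    proof (rule differentiable_at_imp_differentiable_on)
      fix c assume "c \<in> ?B"
      then have "c \<bullet> c < 1" by (simp add: dot_square_norm abs_square_less_1)
      then show "f differentiable at c"
        unfolding f_def differentiable_def
        by (intro exI) (rule derivative_eq_intros refl | simp)+
    qed
    ultimately have "negligible (f ` ?B)"
      by (intro negligible_differentiable_image_negligible) auto
    then have "negligible {z. \<not> z / complex_of_real (norm (z, w)) \<notin> N}"
    proof (rule negligible_subset, intro subsetI)
      fix z assume z: "z \<in> {z. \<not> z / complex_of_real (norm (z, w)) \<notin> N}"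
      define r where "r = norm (z, w)"
      have r2: "r\<^sup>2 = (cmod z)\<^sup>2 + (cmod w)\<^sup>2" by (simp add: r_def norm_prod_def)
      have r0: "r > 0" using w by (simp add: r_def zero_prod_def)
      define c where "c = z / complex_of_real r"
      have cc: "c \<bullet> c = (cmod z)\<^sup>2 / r\<^sup>2"
        using r0 by (simp add: c_def dot_square_norm norm_divide power_divide)
      have "1 - c \<bullet> c = (r\<^sup>2 - (cmod z)\<^sup>2) / r\<^sup>2"
        using r0 cc by (simp add: diff_divide_distrib)
      then have cw: "1 - c \<bullet> c = (cmod w / r)\<^sup>2" by (simp add: r2 power_divide)
      then have sq: "sqrt (1 - c \<bullet> c) = cmod w / r" using r0 by simp
      have "0 < (cmod w / r)\<^sup>2" using w r0 by simp
      then have c1: "(norm c)\<^sup>2 < 1" unfolding cw[symmetric] by (simp add: dot_square_norm)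
      have "f c = z" unfolding f_def sq using w r0 by (simp add: c_def scaleR_conv_of_real)
      moreover have "norm c < 1"
        using c1 by (simp add: abs_square_less_1)
      moreover have "c \<in> N" using z by (simp add: c_def r_def)
      ultimately show "z \<in> f ` ?B" by (intro image_eqI[of _ _ c]) auto
    qed
    then show ?thesis by (simp only: AE_lborel_iff_negligible)
  qed
  have "AE w in lborel. AE z in lborel. z / complex_of_real (norm (z, w :: complex)) \<notin> N"
    using AE_lborel_singleton[of 0] by eventually_elim (rule fibre)
  moreover have m: "{p \<in> space (lborel \<Otimes>\<^sub>M lborel). fst p / norm (p :: complex \<times> complex) \<notin> N} \<in> sets (lborel \<Otimes>\<^sub>M lborel)"
  proof -
    have "{p \<in> space (borel \<Otimes>\<^sub>M borel). fst p / complex_of_real (sqrt ((norm (fst p))\<^sup>2 + (norm (snd p :: complex))\<^sup>2)) \<notin> N} \<in> sets (borel \<Otimes>\<^sub>M borel)"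
      by measurable
    then show ?thesis by (simp add: space_pair_measure norm_prod_def)
  qed
  ultimately have "AE z in lborel. AE w in lborel. z / complex_of_real (norm (z, w :: complex)) \<notin> N"
    by (intro iffD2[OF lborel_pair.AE_commute[of "\<lambda>z w. z / complex_of_real (norm (z, w)) \<notin> N"]]) simp_all
  then have "AE p in lborel \<Otimes>\<^sub>M lborel. fst p / norm (p :: complex \<times> complex) \<notin> N"
    by (intro lborel_pair.AE_pair_measure m) simp
  then show ?thesis unfolding lborel_prod .
qed

lemma lmul_inverse:
  assumes "(cmod u)\<^sup>2 + (cmod v)\<^sup>2 = 1"
  shows "lmul (cnj u) (- v) (lmul u v p) = p"
proof -
  have e: "u * cnj u + v * cnj v = 1" using assms by (simp add: complex_norm_square[symmetric] flip: of_real_add of_real_power)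
  have "lmul (cnj u) (- v) (lmul u v p) = ((u * cnj u + v * cnj v) * fst p, (u * cnj u + v * cnj v) * snd p)"
    by (simp add: lmul_def algebra_simps)
  then show ?thesis unfolding e by simp
qed

lemma rmul_inverse:
  assumes "(cmod u)\<^sup>2 + (cmod v)\<^sup>2 = 1"
  shows "rmul (cnj u) (- v) (rmul u v p) = p"
proof -
  have e: "u * cnj u + v * cnj v = 1" using assms by (simp add: complex_norm_square[symmetric] flip: of_real_add of_real_power)
  have "rmul (cnj u) (- v) (rmul u v p) = ((u * cnj u + v * cnj v) * fst p, (u * cnj u + v * cnj v) * snd p)"
    by (simp add: rmul_def algebra_simps)
  then show ?thesis unfolding e by simp
qed

text \<open>Multiplication on either side by unit quaternions lifts to invertible linear maps of p,
  under which null sets pull back to null sets.\<close>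

lemma AE_unit_quat_mult:
  assumes g: "g \<in> SU2" and h: "h \<in> SU2" and ae: "AE p in lborel. P (unit_quat p)"
  shows "AE p in lborel. P (g ** unit_quat p ** h)"
proof -
  obtain u v where uv: "g = quat u v" "(cmod u)\<^sup>2 + (cmod v)\<^sup>2 = 1" using g by (rule SU2_quat)
  obtain y z where yz: "h = quat y z" "(cmod y)\<^sup>2 + (cmod z)\<^sup>2 = 1" using h by (rule SU2_quat)
  have "AE p in lborel. P (unit_quat (lmul u v p))"
    by (rule AE_linear_preimage[OF ae linear_lmul lmul_inverse[OF uv(2)]])
  then have "AE p in lborel. P (unit_quat (lmul u v (rmul y z p)))"
    by (rule AE_linear_preimage[OF _ linear_rmul rmul_inverse[OF yz(2)]])
  with AE_lborel_singleton[of 0] show ?thesis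
  proof eventually_elim
    fix p :: "complex \<times> complex" assume p: "p \<noteq> 0" "P (unit_quat (lmul u v (rmul y z p)))"
    have "rmul y z p \<noteq> 0" using norm_rmul[OF yz(2), of p] p(1) by auto
    then have "g ** unit_quat p ** h = unit_quat (lmul u v (rmul y z p))"
      unfolding uv(1) yz(1) matrix_mul_assoc[symmetric] unit_quat_rmul[OF yz(2) p(1)] by (rule unit_quat_lmul[OF uv(2)])
    then show "P (g ** unit_quat p ** h)" using p(2) by simp
  qed
qed

text \<open>For diagonal a the two traces depend on the first coordinate alone, through an
  invertible linear map. The general case is conjugated to this one, and left averaging passes from
  Lebesgue to Haar measure.\<close>

lemma haar_AE_re_pair:
  assumes M: "is_haar_SU2 M" and a: "a \<in> SU2" and x: "(qre a)\<^sup>2 < 1" and N: "N \<in> null_sets lborel"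
  shows "AE b in M. (qre b, qre (a ** b)) \<notin> N"
proof -
  define e where "e = Complex (qre a) (sqrt (1 - (qre a)\<^sup>2))"
  obtain g where g: "g \<in> SU2" "a = g ** diag_form (qre a) ** cadj g" using SU2_diagonalize[OF a] .
  have [measurable]: "N \<in> sets (borel \<Otimes>\<^sub>M borel)" using N unfolding borel_prod by (auto dest: null_setsD2)
  have base: "AE p in lborel. (qre (unit_quat p), qre (diag_form (qre a) ** unit_quat p)) \<notin> N"
  proof -
    have "{c \<in> space borel. (Re c, Re (e * c)) \<in> N} \<in> sets borel" by measurable
    then have "AE p in lborel. fst p / norm (p :: complex \<times> complex) \<notin> {c. (Re c, Re (e * c)) \<in> N}"
      by (intro AE_first_coord) (use AE_rel_coord[OF N x] in \<open>simp_all add: e_def\<close>)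
    with AE_lborel_singleton[of 0] show ?thesis
      by eventually_elim (simp add: unit_quat_def diag_form_def quat_mult e_def diff_divide_distrib)
  qed
  have aver: "AE p in lborel. unit_quat p ** b \<notin> {b. (qre b, qre (a ** b)) \<in> N}" if b: "b \<in> SU2" for b
  proof -
    \<comment> \<open>The left factor undoes the diagonalisation of a; the right factor contains the
      point b to be averaged over and completes the conjugation by \<open>g\<close>, which does not
      change traces.\<close>
    have "AE p in lborel. (qre (cadj g ** unit_quat p ** (b ** g)), qre (diag_form (qre a) ** (cadj g ** unit_quat p ** (b ** g)))) \<notin> N"
      by (rule AE_unit_quat_mult[OF _ _ base]) (use g b in simp_all)
    then show ?thesis
    proof eventually_elim
      fix p assume *: "(qre (cadj g ** unit_quat p ** (b ** g)), qre (diag_form (qre a) ** (cadj g ** unit_quat p ** (b ** g)))) \<notin> N"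
      define X where "X = unit_quat p ** b"
      have X: "X \<in> SU2" unfolding X_def using b unit_quat_SU2 by simp
      have d: "diag_form (qre a) \<in> SU2" using x by (intro diag_form_SU2) simp
      have Y: "cadj g ** unit_quat p ** (b ** g) = cadj g ** X ** g" by (simp add: X_def matrix_mul_assoc)
      have 1: "qre (cadj g ** X ** g) = qre X" using qre_conj[OF X cadj_SU2[OF g(1)]] by simp
      have "a ** X = g ** (diag_form (qre a) ** (cadj g ** X ** g)) ** cadj g"
        using g(1) by (subst g(2)) (simp add: matrix_mul_assoc SU2_cancel)
      then have 2: "qre (diag_form (qre a) ** (cadj g ** X ** g)) = qre (a ** X)"
        using qre_conj[of "diag_form (qre a) ** (cadj g ** X ** g)" g] d g X by simp
      show "unit_quat p ** b \<notin> {b. (qre b, qre (a ** b)) \<in> N}"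
        using * unfolding Y 1 2 by (simp add: X_def)
    qed
  qed
  have "{b \<in> space borel. (qre b, qre (a ** b)) \<in> N} \<in> sets borel" by measurable
  then have "AE b in M. b \<notin> {b. (qre b, qre (a ** b)) \<in> N}"
    by (intro haar_null_by_averaging[OF M unit_quat_measurable unit_quat_SU2 _ aver]) simp_all
  then show ?thesis by simp
qed

lemma haar_AE_re:
  assumes M: "is_haar_SU2 M" and ae: "AE x in lborel. P x"
  shows "AE b in M. P (qre b)"
proof -
  obtain N where N: "N \<in> null_sets lborel" "{x. \<not> P x} \<subseteq> N"
    using ae by (auto simp: eventually_ae_filter)
  have "N \<times> UNIV \<in> null_sets (lborel \<Otimes>\<^sub>M (lborel :: real measure))"
    using N(1) lborel.times_in_null_sets1 by auto
  then have "N \<times> UNIV \<in> null_sets (lborel :: (real \<times> real) measure)" unfolding lborel_prod .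
  \<comment> \<open>A noncentral auxiliary element turns the statement about pairs of traces into
    one about the first trace.\<close>
  moreover have "quat \<i> 0 \<in> SU2" "(qre (quat \<i> 0))\<^sup>2 < 1" by (simp_all add: quat_in_SU2_iff)
  ultimately have "AE b in M. (qre b, qre (quat \<i> 0 ** b)) \<notin> N \<times> UNIV"
    using haar_AE_re_pair[OF M] by blast
  then show ?thesis by eventually_elim (use N(2) in auto)
qed

text \<open>The trace of a avoids null sets, in particular the values 1 and -1. For each remaining a
  the pair of traces of b and a b avoids planar null sets; Borel measurability of \<open>P\<close>
  makes the exceptional set of its (y, z)-section such a null set.\<close>

lemma haar_AE_coordinates:
  assumes M: "is_haar_SU2 M"
    and S: "{p. P (fst p) (fst (snd p)) (snd (snd p))} \<in> sets borel"
    and ae: "AE x in lborel. AE y in lborel. AE z in lborel. x\<^sup>2 < 1 \<longrightarrow> P x y z"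
  shows "AE a in M. AE b in M. (qre a)\<^sup>2 < 1 \<and> P (qre a) (qre b) (qre (a ** b))"
proof -
  have S': "{p \<in> space (lborel \<Otimes>\<^sub>M lborel \<Otimes>\<^sub>M lborel). P (fst p) (fst (snd p)) (snd (snd p))} \<in> sets (lborel \<Otimes>\<^sub>M lborel \<Otimes>\<^sub>M lborel)"
    using S unfolding lborel_prod by simp
  have sec [measurable]: "{q \<in> space (lborel \<Otimes>\<^sub>M lborel). P x (fst q) (snd q)} \<in> sets (lborel \<Otimes>\<^sub>M lborel)" for x
    using measurable_sets[OF measurable_Pair1'[of x lborel "lborel \<Otimes>\<^sub>M lborel"] S'] by (simp add: vimage_def space_pair_measure)
  have "AE a in M. (qre a)\<^sup>2 < 1"
  proof -
    have "AE a in M. qre a \<noteq> 1" "AE a in M. qre a \<noteq> - 1"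
      by (rule haar_AE_re[OF M AE_lborel_singleton])+
    with AE_space[of M] show ?thesis
    proof eventually_elim
      case (elim a)
      then have "(qre a)\<^sup>2 \<le> 1" using qre_le_1[of a] haar_space(1)[OF M] by simp
      moreover have "(qre a)\<^sup>2 \<noteq> 1" using elim by (simp add: power2_eq_1_iff)
      ultimately show ?case by simp
    qed
  qed
  with AE_space[of M] haar_AE_re[OF M ae] show ?thesis
  proof eventually_elim
    case (elim a)
    then have a: "a \<in> SU2" by (simp add: haar_space(1)[OF M])
    define x where "x = qre a"
    have "AE q in lborel \<Otimes>\<^sub>M lborel. P x (fst q) (snd q)"
    proof (rule lborel_pair.AE_pair_measure)
      show "{q \<in> space (lborel \<Otimes>\<^sub>M lborel). P x (fst q) (snd q)} \<in> sets (lborel \<Otimes>\<^sub>M lborel)"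
        by measurable
      show "AE y in lborel. AE z in lborel. P x (fst (y, z)) (snd (y, z))"
        using elim(2,3) by (simp add: x_def)
    qed
    then obtain N where N: "N \<in> null_sets lborel" "{q. \<not> P x (fst q) (snd q)} \<subseteq> N"
      unfolding lborel_prod by (auto simp: eventually_ae_filter)
    have "AE b in M. (qre b, qre (a ** b)) \<notin> N"
      by (rule haar_AE_re_pair[OF M a elim(3) N(1)])
    then show ?case
    proof eventually_elim
      fix b assume "(qre b, qre (a ** b)) \<notin> N"
      then have "(qre b, qre (a ** b)) \<notin> {q. \<not> P x (fst q) (snd q)}"
        using N(2) by blast
      then show "(qre a)\<^sup>2 < 1 \<and> P (qre a) (qre b) (qre (a ** b))"
        using elim(3) by (simp add: x_def)
    qed
  qed
qed

section \<open>Displacement of vectors and the spectral gap\<close>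

locale SU2_haar =
  fixes M :: "(complex^2^2) measure"
  assumes haar: "is_haar_SU2 M"
begin

sublocale prob_space M
  using haar by (rule haar_space(3))

lemma space_M: "space M = SU2"
  using haar by (rule haar_space(1))

lemma translation_measurable:
  assumes "g \<in> SU2"
  shows "(\<lambda>h. g ** h) \<in> M \<rightarrow>\<^sub>M M"
proof -
  have "(\<lambda>h :: complex^2^2. g ** h) \<in> borel_measurable borel"
    by (rule borel_measurable_continuous_onI continuous_on_matrix_mult continuous_on_const continuous_on_id)+
  then have "(\<lambda>h. g ** h) \<in> M \<rightarrow>\<^sub>M restrict_space borel SU2"
    using assms by (intro measurable_restrict_space2 haar_borel(1)[OF haar]) (auto simp: space_M)
  then show ?thesis
    using measurable_cong_sets[OF refl haar_space(2)[OF haar]] by blast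
qed

lemma distr_translation:
  assumes "g \<in> SU2"
  shows "distr M M (\<lambda>h. g ** h) = M"
proof (rule measure_eqI)
  fix A assume A: "A \<in> sets (distr M M (\<lambda>h. g ** h))"
  then have "emeasure (distr M M (\<lambda>h. g ** h)) A = emeasure M ((\<lambda>h. g ** h) -` A \<inter> SU2)"
    by (simp add: emeasure_distr[OF translation_measurable[OF assms]] space_M)
  also have "\<dots> = emeasure M A"
    using haar assms A unfolding is_haar_SU2_def by simp
  finally show "emeasure (distr M M (\<lambda>h. g ** h)) A = emeasure M A" .
qed simp

lemma integral_translation:
  fixes f :: "complex^2^2 \<Rightarrow> 'b::{banach, second_countable_topology}"
  assumes "g \<in> SU2" "f \<in> borel_measurable M"
  shows "(\<integral>h. f (g ** h) \<partial>M) = (\<integral>h. f h \<partial>M)"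
  using integral_distr[OF translation_measurable[OF assms(1)] assms(2)]
  by (simp add: distr_translation[OF assms(1)])

lemma integrable_translation:
  fixes f :: "complex^2^2 \<Rightarrow> 'b::{banach, second_countable_topology}"
  assumes "g \<in> SU2" "integrable M f"
  shows "integrable M (\<lambda>h. f (g ** h))"
  using integrable_distr[OF translation_measurable[OF assms(1)], of f] assms(2)
  by (simp add: distr_translation[OF assms(1)])

lemma lreg_measurable:
  assumes "g \<in> SU2" "v \<in> borel_measurable M"
  shows "lreg g v \<in> borel_measurable M"
  unfolding lreg_def
  using measurable_compose[OF translation_measurable[OF cadj_SU2[OF assms(1)]] assms(2)] .

definition L2 :: "(complex^2^2 \<Rightarrow> complex) set" where
  "L2 = {v. v \<in> borel_measurable M \<and> integrable M (\<lambda>h. (cmod (v h))\<^sup>2)}"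

definition sqnorm :: "(complex^2^2 \<Rightarrow> complex) \<Rightarrow> real" where
  "sqnorm v = (\<integral>h. (cmod (v h))\<^sup>2 \<partial>M)"

text \<open>Squared norms, with the factor 2 in \<open>displ_mult\<close>, suffice and avoid Minkowski's inequality.\<close>

definition displ :: "complex^2^2 \<Rightarrow> (complex^2^2 \<Rightarrow> complex) \<Rightarrow> real" where
  "displ g v = sqnorm (\<lambda>h. lreg g v h - v h)"

lemma L2_0_subset_L2: "v \<in> L2_0 M \<Longrightarrow> v \<in> L2"
  by (simp add: L2_0_def L2_def)

lemma cmod_add_square_le: "(cmod (x + y))\<^sup>2 \<le> 2 * (cmod x)\<^sup>2 + 2 * (cmod y)\<^sup>2"
proof -
  have "(cmod (x + y))\<^sup>2 \<le> (cmod x + cmod y)\<^sup>2"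
    by (intro power_mono norm_triangle_ineq) auto
  also have "\<dots> \<le> 2 * (cmod x)\<^sup>2 + 2 * (cmod y)\<^sup>2"
    using sum_squares_bound[of "cmod x" "cmod y"] by (simp add: power2_sum)
  finally show ?thesis .
qed

lemma sqnorm_nonneg: "0 \<le> sqnorm v"
  by (simp add: sqnorm_def)

lemma L2_add:
  assumes "v \<in> L2" "w \<in> L2"
  shows "(\<lambda>h. v h + w h) \<in> L2" "sqnorm (\<lambda>h. v h + w h) \<le> 2 * sqnorm v + 2 * sqnorm w"
proof -
  have [measurable]: "v \<in> borel_measurable M" "w \<in> borel_measurable M"
    and i: "integrable M (\<lambda>h. (cmod (v h))\<^sup>2)" "integrable M (\<lambda>h. (cmod (w h))\<^sup>2)"
    using assms by (auto simp: L2_def)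
  have i': "integrable M (\<lambda>h. 2 * (cmod (v h))\<^sup>2 + 2 * (cmod (w h))\<^sup>2)" using i by simp
  have i'': "integrable M (\<lambda>h. (cmod (v h + w h))\<^sup>2)"
    by (rule Bochner_Integration.integrable_bound[OF i']) (auto simp: cmod_add_square_le)
  then show "(\<lambda>h. v h + w h) \<in> L2" by (simp add: L2_def)
  have "sqnorm (\<lambda>h. v h + w h) \<le> (\<integral>h. 2 * (cmod (v h))\<^sup>2 + 2 * (cmod (w h))\<^sup>2 \<partial>M)"
    unfolding sqnorm_def by (rule integral_mono[OF i'' i']) (rule cmod_add_square_le)
  also have "\<dots> = 2 * sqnorm v + 2 * sqnorm w"
    using i by (simp add: sqnorm_def)
  finally show "sqnorm (\<lambda>h. v h + w h) \<le> 2 * sqnorm v + 2 * sqnorm w" .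
qed

lemma L2_minus:
  assumes "v \<in> L2" shows "(\<lambda>h. - v h) \<in> L2" "sqnorm (\<lambda>h. - v h) = sqnorm v"
  using assms by (auto simp: L2_def sqnorm_def)

lemma L2_diff:
  assumes "v \<in> L2" "w \<in> L2"
  shows "(\<lambda>h. v h - w h) \<in> L2" "sqnorm (\<lambda>h. v h - w h) \<le> 2 * sqnorm v + 2 * sqnorm w"
  using L2_add[OF assms(1) L2_minus(1)[OF assms(2)]] L2_minus(2)[OF assms(2)] by simp_all

lemma L2_lreg:
  assumes g: "g \<in> SU2" and v: "v \<in> L2"
  shows "lreg g v \<in> L2" "sqnorm (lreg g v) = sqnorm v"
proof -
  have vm: "v \<in> borel_measurable M" and vi: "integrable M (\<lambda>h. (cmod (v h))\<^sup>2)"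
    using v by (auto simp: L2_def)
  show "lreg g v \<in> L2"
    using lreg_measurable[OF g vm] integrable_translation[OF cadj_SU2[OF g] vi]
    by (simp add: L2_def lreg_def)
  show "sqnorm (lreg g v) = sqnorm v"
    unfolding sqnorm_def lreg_def
    by (rule integral_translation[OF cadj_SU2[OF g]]) (use vi in auto)
qed

lemma L2_0_lreg:
  assumes g: "g \<in> SU2" and v: "v \<in> L2_0 M"
  shows "lreg g v \<in> L2_0 M"
proof -
  have vm: "v \<in> borel_measurable M" using v by (simp add: L2_0_def)
  have "(\<integral>h. lreg g v h \<partial>M) = 0"
    unfolding lreg_def using integral_translation[OF cadj_SU2[OF g] vm] v by (simp add: L2_0_def)
  then show ?thesis
    using L2_lreg(1)[OF g L2_0_subset_L2[OF v]] by (simp add: L2_0_def L2_def)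
qed

lemma lreg_mult: "lreg (g ** k) v = lreg g (lreg k v)"
  by (simp add: lreg_def cadj_mult matrix_mul_assoc)

lemma lreg_one: "lreg (mat 1) v = v"
  by (simp add: lreg_def mat_1_quat cadj_quat) (simp flip: mat_1_quat)

lemma lreg_diff: "lreg g (\<lambda>h. v h - w h) = (\<lambda>h. lreg g v h - lreg g w h)"
  by (simp add: lreg_def)

text \<open>Write \<lambda>(g k) v - v as (\<lambda>(g) v - v) + \<lambda>(g) (\<lambda>(k) v - v)
  and use that \<lambda>(g) is isometric.\<close>

lemma displ_mult:
  assumes "g \<in> SU2" "k \<in> SU2" "v \<in> L2"
  shows "displ (g ** k) v \<le> 2 * displ g v + 2 * displ k v"
proof -
  have kv: "(\<lambda>h. lreg k v h - v h) \<in> L2" by (intro L2_diff L2_lreg assms)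
  have "displ (g ** k) v = sqnorm (\<lambda>h. (lreg g v h - v h) + lreg g (\<lambda>h. lreg k v h - v h) h)"
    unfolding displ_def lreg_mult lreg_diff by (intro arg_cong[where f = sqnorm] ext) simp
  also have "\<dots> \<le> 2 * sqnorm (\<lambda>h. lreg g v h - v h) + 2 * sqnorm (lreg g (\<lambda>h. lreg k v h - v h))"
    by (intro L2_add L2_diff L2_lreg kv assms)
  also have "\<dots> = 2 * displ g v + 2 * displ k v"
    using L2_lreg(2)[OF assms(1) kv] by (simp add: displ_def)
  finally show ?thesis .
qed

lemma displ_cadj:
  assumes "g \<in> SU2" "v \<in> L2"
  shows "displ (cadj g) v = displ g v"
proof -
  have gv: "(\<lambda>h. lreg (cadj g) v h - v h) \<in> L2" by (intro L2_diff L2_lreg cadj_SU2 assms)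
  have "displ (cadj g) v = sqnorm (lreg g (\<lambda>h. lreg (cadj g) v h - v h))"
    unfolding displ_def using L2_lreg(2)[OF assms(1) gv] by simp
  also have "lreg g (\<lambda>h. lreg (cadj g) v h - v h) = (\<lambda>h. - (lreg g v h - v h))"
    unfolding lreg_diff using assms(1) by (simp add: lreg_mult[symmetric] lreg_one)
  also have "sqnorm \<dots> = displ g v"
    unfolding displ_def by (intro L2_minus L2_diff L2_lreg assms)
  finally show ?thesis .
qed

lemma displ_conj:
  assumes "g \<in> SU2" "k \<in> SU2" "v \<in> L2"
  shows "displ (k ** g ** cadj k) (lreg k v) = displ g v"
proof -
  have gv: "(\<lambda>h. lreg g v h - v h) \<in> L2" by (intro L2_diff L2_lreg assms)
  have "lreg (k ** g ** cadj k) (lreg k v) = lreg (k ** g) v"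
    using assms(2) by (simp add: lreg_mult[symmetric] SU2_cancel)
  then have "displ (k ** g ** cadj k) (lreg k v) = sqnorm (lreg k (\<lambda>h. lreg g v h - v h))"
    by (simp add: displ_def lreg_diff lreg_mult)
  then show ?thesis using L2_lreg(2)[OF assms(2) gv] by (simp add: displ_def)
qed

lemma L2norm_eq: "L2norm M v = sqrt (sqnorm v)"
  by (simp add: L2norm_def sqnorm_def)

section \<open>The spectral gap under operations on pairs\<close>

lemma spectral_gap_pair_iff:
  "spectral_gap M [a, b] \<longleftrightarrow>
    (\<exists>e>0. \<forall>v\<in>L2_0 M. e * sqnorm v \<le> displ a v \<or> e * sqnorm v \<le> displ b v)"
proof
  assume "spectral_gap M [a, b]"
  then obtain e where e: "e > 0" "\<And>v. v \<in> L2_0 M \<Longrightarrow>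
      e * sqrt (sqnorm v) \<le> sqrt (displ a v) \<or> e * sqrt (sqnorm v) \<le> sqrt (displ b v)"
    by (auto simp: spectral_gap_def L2norm_eq displ_def)
  have "e * sqrt (sqnorm v) \<le> sqrt (displ g v) \<Longrightarrow> e\<^sup>2 * sqnorm v \<le> displ g v" for g v
    using power_mono[of "e * sqrt (sqnorm v)" "sqrt (displ g v)" 2] e(1)
    by (simp add: power_mult_distrib sqnorm_nonneg displ_def)
  then show "\<exists>e>0. \<forall>v\<in>L2_0 M. e * sqnorm v \<le> displ a v \<or> e * sqnorm v \<le> displ b v"
    using e by (intro exI[of _ "e\<^sup>2"]) (auto, blast)
next
  assume "\<exists>e>0. \<forall>v\<in>L2_0 M. e * sqnorm v \<le> displ a v \<or> e * sqnorm v \<le> displ b v"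
  then obtain e where e: "e > 0" "\<And>v. v \<in> L2_0 M \<Longrightarrow> e * sqnorm v \<le> displ a v \<or> e * sqnorm v \<le> displ b v"
    by auto
  have "e * sqnorm v \<le> displ g v \<Longrightarrow> sqrt e * sqrt (sqnorm v) \<le> sqrt (displ g v)" for g v
    by (simp flip: real_sqrt_mult)
  then have "\<forall>v\<in>L2_0 M. \<exists>g\<in>set [a, b]. sqrt e * sqrt (sqnorm v) \<le> sqrt (displ g v)"
    using e(2) by (metis list.set_intros(1) list.set_intros(2))
  then show "spectral_gap M [a, b]"
    unfolding spectral_gap_def L2norm_eq displ_def using e(1) by (intro exI[of _ "sqrt e"]) simp
qed

text \<open>If the new generators displace v little whenever the old ones do, a gap for the new pair
  forces the sum of the old displacements to be large, and the larger summand is at least half the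
  sum. This produces the constant e / (2 C).\<close>

lemma spectral_gap_transfer:
  assumes gap: "spectral_gap M [a', b']" and C: "C > 0"
    and a': "\<And>v. v \<in> L2 \<Longrightarrow> displ a' v \<le> C * (displ a v + displ b v)"
    and b': "\<And>v. v \<in> L2 \<Longrightarrow> displ b' v \<le> C * (displ a v + displ b v)"
  shows "spectral_gap M [a, b]"
proof -
  obtain e where e: "e > 0" "\<And>v. v \<in> L2_0 M \<Longrightarrow> e * sqnorm v \<le> displ a' v \<or> e * sqnorm v \<le> displ b' v"
    using gap unfolding spectral_gap_pair_iff by auto
  have "e / (2 * C) * sqnorm v \<le> displ a v \<or> e / (2 * C) * sqnorm v \<le> displ b v" if v: "v \<in> L2_0 M" for v
  proof -
    have "e * sqnorm v \<le> C * (displ a v + displ b v)"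
      using e(2)[OF v] a' b' L2_0_subset_L2[OF v] by (meson order_trans)
    then have "e / (2 * C) * sqnorm v \<le> (displ a v + displ b v) / 2"
      using C by (simp add: field_simps)
    moreover have "t \<le> p \<or> t \<le> q" if "t \<le> (p + q) / 2" for t p q :: real
    proof (rule ccontr)
      assume "\<not> (t \<le> p \<or> t \<le> q)"
      then have "p + q < t + t" by (intro add_strict_mono) auto
      with that show False by simp
    qed
    ultimately show ?thesis by blast
  qed
  then show ?thesis unfolding spectral_gap_pair_iff using e C by (intro exI[of _ "e / (2 * C)"]) auto
qed

lemma displ_nonneg: "0 \<le> displ g v"
  by (simp add: displ_def sqnorm_nonneg)

lemma spectral_gap_swap: "spectral_gap M [a, b] \<longleftrightarrow> spectral_gap M [b, a]"
  unfolding spectral_gap_pair_iff by blast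

lemma spectral_gap_mult_iff:
  assumes a: "a \<in> SU2" and b: "b \<in> SU2"
  shows "spectral_gap M [a, a ** b] \<longleftrightarrow> spectral_gap M [a, b]"
proof
  assume "spectral_gap M [a, a ** b]"
  then show "spectral_gap M [a, b]"
  proof (rule spectral_gap_transfer[where C = 2])
    fix v assume v: "v \<in> L2"
    show "displ a v \<le> 2 * (displ a v + displ b v)" "displ (a ** b) v \<le> 2 * (displ a v + displ b v)"
      using displ_mult[OF a b v] displ_nonneg[of a v] displ_nonneg[of b v] by simp_all
  qed simp
next
  assume "spectral_gap M [a, b]"
  then show "spectral_gap M [a, a ** b]"
  proof (rule spectral_gap_transfer[where C = 2])
    fix v assume v: "v \<in> L2"
    \<comment> \<open>Here b is the product of the inverse of a with a b, and the inverse of a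
      displaces v as much as a does.\<close>
    show "displ a v \<le> 2 * (displ a v + displ (a ** b) v)" "displ b v \<le> 2 * (displ a v + displ (a ** b) v)"
      using displ_mult[OF cadj_SU2[OF a] mult_SU2[OF a b] v] displ_cadj[OF a v]
        displ_nonneg[of a v] displ_nonneg[of "a ** b" v] a by (simp_all add: SU2_cancel)
  qed simp
qed

lemma spectral_gap_square:
  assumes a: "a \<in> SU2" and gap: "spectral_gap M [a ** a, b]"
  shows "spectral_gap M [a, b]"
  using gap
\<comment> \<open>Both factors of a a contribute 2 in \<open>displ_mult\<close>.\<close>
proof (rule spectral_gap_transfer[where C = 4])
  fix v assume v: "v \<in> L2"
  show "displ (a ** a) v \<le> 4 * (displ a v + displ b v)" "displ b v \<le> 4 * (displ a v + displ b v)"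
    using displ_mult[OF a a v] displ_nonneg[of a v] displ_nonneg[of b v] by simp_all
qed simp

lemma spectral_gap_conj:
  assumes "a \<in> SU2" "b \<in> SU2" "k \<in> SU2" and gap: "spectral_gap M [a, b]"
  shows "spectral_gap M [k ** a ** cadj k, k ** b ** cadj k]"
proof -
  obtain e where e: "e > 0" "\<And>v. v \<in> L2_0 M \<Longrightarrow> e * sqnorm v \<le> displ a v \<or> e * sqnorm v \<le> displ b v"
    using gap unfolding spectral_gap_pair_iff by auto
  have "e * sqnorm v \<le> displ (k ** a ** cadj k) v \<or> e * sqnorm v \<le> displ (k ** b ** cadj k) v"
    if v: "v \<in> L2_0 M" for v
  proof -
    define w where "w = lreg (cadj k) v"
    have w: "w \<in> L2_0 M" "sqnorm w = sqnorm v" "lreg k w = v"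
      unfolding w_def using L2_0_lreg[OF cadj_SU2 v] L2_lreg(2)[OF cadj_SU2 L2_0_subset_L2[OF v]] assms(3)
      by (simp_all add: lreg_one flip: lreg_mult)
    show ?thesis
      using e(2)[OF w(1)] displ_conj[OF assms(1,3) L2_0_subset_L2[OF w(1)]]
        displ_conj[OF assms(2,3) L2_0_subset_L2[OF w(1)]] w by simp
  qed
  then show ?thesis unfolding spectral_gap_pair_iff using e by blast
qed

end

section \<open>Strong continuity and measurability of the set of gap pairs\<close>

context SU2_haar
begin

lemma escape_measurable:
  assumes A: "A \<in> sets M" and g: "g \<in> SU2" and B: "B \<in> sets borel"
  shows "{h \<in> A. cadj g ** h \<notin> B} \<in> sets M"
proof -
  have "(\<lambda>h. cadj g ** h) -` (B \<inter> SU2) \<inter> space M \<in> sets M"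
    by (rule measurable_sets[OF translation_measurable[OF cadj_SU2[OF g]] haar_borel(2)[OF haar B]])
  then have "A - ((\<lambda>h. cadj g ** h) -` (B \<inter> SU2) \<inter> space M) \<in> sets M" using A by blast
  also have "A - ((\<lambda>h. cadj g ** h) -` (B \<inter> SU2) \<inter> space M) = {h \<in> A. cadj g ** h \<notin> B}"
    using sets.sets_into_space[OF A] cadj_SU2[OF g] by (auto simp: space_M)
  finally show ?thesis .
qed

lemma translation_tendsto:
  fixes h :: "complex^2^2"
  assumes "g \<longlonglongrightarrow> mat 1"
  shows "(\<lambda>n. cadj (g n) ** h) \<longlonglongrightarrow> h"
proof -
  have "isCont (\<lambda>k. cadj k ** h) (mat 1)"
    using continuous_on_matrix_mult[OF continuous_on_cadj[OF continuous_on_id] continuous_on_const, of UNIV h]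
    by (simp add: continuous_on_eq_continuous_at)
  from isCont_tendsto_compose[OF this assms] show ?thesis
    by (simp add: mat_1_quat cadj_quat) (simp flip: mat_1_quat)
qed

text \<open>Outer regularity of \<open>M\<close> reduces this to an open set, where it is dominated convergence.\<close>

lemma escape_tendsto_0:
  assumes A: "A \<in> sets M" and g: "\<And>n. g n \<in> SU2" and lim: "g \<longlonglongrightarrow> mat 1"
  shows "(\<lambda>n. measure M {h \<in> A. cadj (g n) ** h \<notin> A}) \<longlonglongrightarrow> 0"
proof (rule LIMSEQ_I)
  fix \<eta> :: real assume \<eta>: "0 < \<eta>"
  obtain A' where A': "A' \<in> sets borel" "A = A' \<inter> SU2"
    using A unfolding haar_space(2)[OF haar] sets_restrict_space by blast
  have idm: "(\<lambda>x. x) \<in> M \<rightarrow>\<^sub>M borel" by (rule haar_borel(1)[OF haar]) simp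
  \<comment> \<open>Outer regularity is applied on the space of all matrices, so \<open>M\<close> is
    first pushed forward along the inclusion.\<close>
  define N where "N = distr M borel (\<lambda>x. x)"
  have N: "emeasure N B = emeasure M (B \<inter> SU2)" if "B \<in> sets borel" for B
    using that by (simp add: N_def emeasure_distr[OF idm] space_M)
  have "emeasure N A' < emeasure N A' + ennreal (\<eta> / 2)"
    using \<eta> emeasure_finite[of A] N[OF A'(1)] A'(2) by (simp add: ennreal_add_left_cancel_less top.not_eq_extremum)
  moreover have "emeasure N A' = (INF U \<in> {U. A' \<subseteq> U \<and> open U}. emeasure N U)"
    by (rule outer_regular) (use A' N[of UNIV] in \<open>auto simp: N_def\<close>)
  ultimately have "(INF U \<in> {U. A' \<subseteq> U \<and> open U}. emeasure N U) < emeasure N A' + ennreal (\<eta> / 2)"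
    by metis
  then obtain U where U: "A' \<subseteq> U" "open U" "emeasure N U < emeasure N A' + ennreal (\<eta> / 2)"
    unfolding INF_less_iff by blast
  have [simp]: "U \<in> sets borel" using U(2) by (rule borel_open)
  define D where "D = (U - A') \<inter> SU2"
  have D: "D \<in> sets M" unfolding D_def using A'(1) by (intro haar_borel(2)[OF haar] sets.Diff) simp_all
  have US: "U \<inter> SU2 \<in> sets M" by (intro haar_borel(2)[OF haar]) simp
  have "measure M (U \<inter> SU2) < measure M A + \<eta> / 2"
    using U(3) N[OF A'(1)] N[of U] A'(2) \<eta>
    by (simp add: emeasure_eq_measure ennreal_less_iff flip: ennreal_plus)
  moreover have "measure M D = measure M (U \<inter> SU2) - measure M A"
  proof -
    have "D = (U \<inter> SU2) - A" using A' by (auto simp: D_def)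
    then show ?thesis using finite_measure_Diff[OF US A] A' U by auto
  qed
  ultimately have D2: "measure M D < \<eta> / 2" by simp
  define E where "E n = {h \<in> A. cadj (g n) ** h \<notin> U}" for n
  have E: "E n \<in> sets M" for n unfolding E_def by (rule escape_measurable[OF A g]) simp
  have "(\<lambda>n. \<integral>h. indicat_real (E n) h \<partial>M) \<longlonglongrightarrow> (\<integral>h. 0 \<partial>M)"
  proof (rule integral_dominated_convergence[where w = "\<lambda>_. 1"])
    show "AE h in M. (\<lambda>n. indicat_real (E n) h) \<longlonglongrightarrow> 0"
    proof (rule AE_I2)
      fix h assume "h \<in> space M"
      have "eventually (\<lambda>n. h \<notin> E n) sequentially"
      proof (cases "h \<in> A")
        case True
        then have "h \<in> U" using A' U by auto
        from topological_tendstoD[OF translation_tendsto[OF lim] U(2) this]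
        show ?thesis by (auto simp: E_def elim!: eventually_mono)
      qed (simp add: E_def)
      then show "(\<lambda>n. indicat_real (E n) h) \<longlonglongrightarrow> 0"
        by (intro tendsto_eventually) (auto elim!: eventually_mono)
    qed
  qed (use E in \<open>auto simp: indicator_def\<close>)
  then have "(\<lambda>n. measure M (E n)) \<longlonglongrightarrow> 0" using E by simp
  then obtain n0 where n0: "\<And>n. n \<ge> n0 \<Longrightarrow> measure M (E n) < \<eta> / 2"
    using LIMSEQ_D[of _ 0 "\<eta> / 2"] \<eta> by fastforce
  show "\<exists>n0. \<forall>n\<ge>n0. norm (measure M {h \<in> A. cadj (g n) ** h \<notin> A} - 0) < \<eta>"
  proof (intro exI allI impI)
    fix n assume n: "n \<ge> n0"
    let ?D = "(\<lambda>h. cadj (g n) ** h) -` D \<inter> space M"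
    have Dm: "?D \<in> sets M" by (rule measurable_sets[OF translation_measurable[OF cadj_SU2[OF g]] D])
    \<comment> \<open>A translated point that leaves \<open>A\<close> either leaves
      \<open>U\<close>, or lands in the part of \<open>U\<close> outside \<open>A\<close>. The
      second event has the small measure of \<open>D\<close>, by invariance.\<close>
    have "measure M {h \<in> A. cadj (g n) ** h \<notin> A} \<le> measure M (E n \<union> ?D)"
      by (rule finite_measure_mono)
        (use sets.sets_into_space[OF A] cadj_SU2[OF g[of n]] A' E Dm in \<open>auto simp: E_def D_def space_M\<close>)
    also have "\<dots> \<le> measure M (E n) + measure M ?D"
      by (rule measure_Un_le[OF E Dm])
    also have "measure M ?D = measure (distr M M (\<lambda>h. cadj (g n) ** h)) D"
      by (rule measure_distr[symmetric, OF translation_measurable[OF cadj_SU2[OF g]] D])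
    also have "\<dots> = measure M D" by (simp add: distr_translation[OF cadj_SU2[OF g]])
    finally show "norm (measure M {h \<in> A. cadj (g n) ** h \<notin> A} - 0) < \<eta>"
      using n0[OF n] D2 by simp
  qed
qed

lemma simple_L2:
  assumes "simple_function M s"
  shows "s \<in> L2"
proof -
  have [measurable]: "s \<in> borel_measurable M" using assms by (rule borel_measurable_simple_function)
  have fin: "finite (s ` space M)" using assms by (simp add: simple_function_def)
  obtain B where B: "\<And>h. h \<in> space M \<Longrightarrow> cmod (s h) \<le> B"
    using finite_imp_bounded[OF fin] by (auto simp: bounded_iff)
  have "integrable M (\<lambda>h. (cmod (s h))\<^sup>2)"
    by (rule integrable_const_bound[of _ "B\<^sup>2"]) (use B in \<open>auto intro!: power_mono\<close>)
  then show ?thesis by (simp add: L2_def)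
qed

text \<open>The translate of s can differ from s only at points that leave their level set, and
  there by at most 2 B. There are finitely many level sets, and each of the escaping parts has
  measure tending to 0.\<close>

lemma displ_simple_tendsto_0:
  assumes s: "simple_function M s" and g: "\<And>n. g n \<in> SU2" and lim: "g \<longlonglongrightarrow> mat 1"
  shows "(\<lambda>n. displ (g n) s) \<longlonglongrightarrow> 0"
proof -
  have fin: "finite (s ` space M)" using s by (simp add: simple_function_def)
  obtain B where B: "\<And>h. h \<in> space M \<Longrightarrow> cmod (s h) \<le> B"
    using finite_imp_bounded[OF fin] by (auto simp: bounded_iff)
  define A where "A y = s -` {y} \<inter> space M" for y
  have A: "A y \<in> sets M" for y unfolding A_def using s by (rule simple_functionD(2))
  define E where "E n y = {h \<in> A y. cadj (g n) ** h \<notin> A y}" for n y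
  have E: "E n y \<in> sets M" for n y
  proof -
    have pre: "(\<lambda>h. cadj (g n) ** h) -` A y \<inter> space M \<in> sets M"
      by (rule measurable_sets[OF translation_measurable[OF cadj_SU2[OF g]] A])
    have eq: "E n y = A y - ((\<lambda>h. cadj (g n) ** h) -` A y \<inter> space M)"
      using sets.sets_into_space[OF A[of y]] unfolding E_def by blast
    show ?thesis unfolding eq by (rule sets.Diff[OF A pre])
  qed
  have ind: "integrable M (indicat_real (E n y))" for n y
    by (rule integrable_real_indicator[OF E]) (simp add: emeasure_eq_measure)
  have bound: "displ (g n) s \<le> (\<Sum>y\<in>s ` space M. (2 * B)\<^sup>2 * measure M (E n y))" for n
  proof -
    have "displ (g n) s \<le> (\<integral>h. (\<Sum>y\<in>s ` space M. (2 * B)\<^sup>2 * indicat_real (E n y) h) \<partial>M)"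
      unfolding displ_def sqnorm_def
    proof (rule integral_mono)
      show "integrable M (\<lambda>h. (cmod (lreg (g n) s h - s h))\<^sup>2)"
        using L2_diff(1)[OF L2_lreg(1)[OF g simple_L2[OF s]] simple_L2[OF s]] by (simp add: L2_def)
      show "integrable M (\<lambda>h. \<Sum>y\<in>s ` space M. (2 * B)\<^sup>2 * indicat_real (E n y) h)"
        by (intro Bochner_Integration.integrable_sum integrable_mult_right ind)
      fix h assume h: "h \<in> space M"
      then have gh: "cadj (g n) ** h \<in> space M" using g cadj_SU2 by (simp add: space_M)
      show "(cmod (lreg (g n) s h - s h))\<^sup>2 \<le> (\<Sum>y\<in>s ` space M. (2 * B)\<^sup>2 * indicat_real (E n y) h)"
      proof (cases "s (cadj (g n) ** h) = s h")
        case True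
        then show ?thesis by (simp add: lreg_def sum_nonneg)
      next
        case False
        have "cmod (lreg (g n) s h - s h) \<le> 2 * B"
          using norm_triangle_ineq4[of "s (cadj (g n) ** h)" "s h"] B[OF h] B[OF gh] by (simp add: lreg_def)
        then have "(cmod (lreg (g n) s h - s h))\<^sup>2 \<le> (2 * B)\<^sup>2" by (intro power_mono) auto
        also have "\<dots> = (2 * B)\<^sup>2 * indicat_real (E n (s h)) h"
          using False h by (simp add: E_def A_def)
        also have "\<dots> \<le> (\<Sum>y\<in>s ` space M. (2 * B)\<^sup>2 * indicat_real (E n y) h)"
          using h fin by (intro member_le_sum) auto
        finally show ?thesis .
      qed
    qed
    also have "\<dots> = (\<Sum>y\<in>s ` space M. (2 * B)\<^sup>2 * measure M (E n y))"
      using E by (subst Bochner_Integration.integral_sum) (simp_all add: ind)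
    finally show ?thesis .
  qed
  have "(\<lambda>n. \<Sum>y\<in>s ` space M. (2 * B)\<^sup>2 * measure M (E n y)) \<longlonglongrightarrow> (\<Sum>y\<in>s ` space M. (2 * B)\<^sup>2 * 0)"
    unfolding E_def by (intro tendsto_intros escape_tendsto_0 A g lim)
  then have "(\<lambda>n. \<Sum>y\<in>s ` space M. (2 * B)\<^sup>2 * measure M (E n y)) \<longlonglongrightarrow> 0" by simp
  then show ?thesis
    by (rule tendsto_sandwich[OF _ _ tendsto_const, rotated -1])
      (use bound displ_nonneg in \<open>auto intro!: always_eventually\<close>)
qed

lemma displ_approx:
  assumes g: "g \<in> SU2" and v: "v \<in> L2" and w: "w \<in> L2"
  shows "displ g v \<le> 8 * sqnorm (\<lambda>h. v h - w h) + 2 * displ g w"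
proof -
  define u where "u = (\<lambda>h. v h - w h)"
  have u: "u \<in> L2" unfolding u_def by (rule L2_diff[OF v w])
  have "displ g v = sqnorm (\<lambda>h. (lreg g u h - u h) + (lreg g w h - w h))"
    unfolding displ_def u_def lreg_diff by (intro arg_cong[where f = sqnorm] ext) simp
  also have "\<dots> \<le> 2 * sqnorm (\<lambda>h. lreg g u h - u h) + 2 * displ g w"
    unfolding displ_def[of g w] by (intro L2_add L2_diff L2_lreg g u w)
  \<comment> \<open>The isometry bounds this by 4 times the squared norm of u; together with the
    preceding factor 2 it gives 8.\<close>
  also have "sqnorm (\<lambda>h. lreg g u h - u h) \<le> 2 * sqnorm (lreg g u) + 2 * sqnorm u"
    by (intro L2_diff L2_lreg g u)
  also have "sqnorm (lreg g u) = sqnorm u" by (rule L2_lreg(2)[OF g u])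
  finally show ?thesis by (simp add: u_def)
qed

text \<open>Strong continuity of the regular representation at the identity, obtained from simple
  functions by approximation in the L2 norm that is uniform in the group element.\<close>

lemma displ_tendsto_0:
  assumes v: "v \<in> L2" and g: "\<And>n. g n \<in> SU2" and lim: "g \<longlonglongrightarrow> mat 1"
  shows "(\<lambda>n. displ (g n) v) \<longlonglongrightarrow> 0"
proof (rule LIMSEQ_I)
  fix \<eta> :: real assume \<eta>: "0 < \<eta>"
  have vm [measurable]: "v \<in> borel_measurable M" and vi: "integrable M (\<lambda>h. (cmod (v h))\<^sup>2)"
    using v by (auto simp: L2_def)
  obtain F where F: "\<And>i. simple_function M (F i)" "\<And>h. h \<in> space M \<Longrightarrow> (\<lambda>i. F i h) \<longlonglongrightarrow> v h"
    "\<And>i h. h \<in> space M \<Longrightarrow> cmod (F i h) \<le> 2 * cmod (v h)"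
    using borel_measurable_implies_sequence_metric[OF vm, of 0]
    by (simp only: dist_norm diff_zero) blast
  have [measurable]: "F i \<in> borel_measurable M" for i using F(1) by (rule borel_measurable_simple_function)
  have "(\<lambda>i. sqnorm (\<lambda>h. v h - F i h)) \<longlonglongrightarrow> (\<integral>h. 0 \<partial>M)"
    unfolding sqnorm_def
  \<comment> \<open>The approximants satisfy |F i| \<le> 2 |v|, so |v - F i| \<le> 3 |v|.\<close>
  proof (rule integral_dominated_convergence[where w = "\<lambda>h. 9 * (cmod (v h))\<^sup>2"])
    show "AE h in M. (\<lambda>i. (cmod (v h - F i h))\<^sup>2) \<longlonglongrightarrow> 0"
    proof (rule AE_I2)
      fix h assume "h \<in> space M"
      then have "(\<lambda>i. (cmod (v h - F i h))\<^sup>2) \<longlonglongrightarrow> (cmod (v h - v h))\<^sup>2"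
        by (intro tendsto_intros F)
      then show "(\<lambda>i. (cmod (v h - F i h))\<^sup>2) \<longlonglongrightarrow> 0" by simp
    qed
    show "AE h in M. norm ((cmod (v h - F i h))\<^sup>2) \<le> 9 * (cmod (v h))\<^sup>2" for i
    proof (rule AE_I2)
      fix h assume "h \<in> space M"
      then have "cmod (v h - F i h) \<le> 3 * cmod (v h)"
        using norm_triangle_ineq4[of "v h" "F i h"] F(3)[of h i] by simp
      then have "(cmod (v h - F i h))\<^sup>2 \<le> (3 * cmod (v h))\<^sup>2" by (intro power_mono) auto
      then show "norm ((cmod (v h - F i h))\<^sup>2) \<le> 9 * (cmod (v h))\<^sup>2" by (simp add: power_mult_distrib)
    qed
  qed (use vi in auto)
  \<comment> \<open>The tolerances \<eta>/16 here and \<eta>/4 below add up, in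
    \<open>displ_approx\<close>, to 8 \<eta>/16 + 2 \<eta>/4 = \<eta>.\<close>
  then obtain i where "norm (sqnorm (\<lambda>h. v h - F i h) - 0) < \<eta> / 16"
    using LIMSEQ_D[of "\<lambda>i. sqnorm (\<lambda>h. v h - F i h)" 0 "\<eta> / 16"] \<eta> by auto
  then have i: "sqnorm (\<lambda>h. v h - F i h) < \<eta> / 16" by simp
  obtain n0 where n0: "\<And>n. n \<ge> n0 \<Longrightarrow> norm (displ (g n) (F i) - 0) < \<eta> / 4"
    using LIMSEQ_D[OF displ_simple_tendsto_0[OF F(1) g lim], of "\<eta> / 4"] \<eta> by auto
  show "\<exists>n0. \<forall>n\<ge>n0. norm (displ (g n) v - 0) < \<eta>"
  proof (intro exI allI impI)
    fix n assume "n \<ge> n0"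
    then have "displ (g n) (F i) < \<eta> / 4" using n0 by fastforce
    then show "norm (displ (g n) v - 0) < \<eta>"
      using displ_approx[OF g v simple_L2[OF F(1)], of n i] i displ_nonneg[of "g n" v] by simp
  qed
qed

definition gap_pairs :: "real \<Rightarrow> ((complex^2^2) \<times> (complex^2^2)) set" where
  "gap_pairs e = {p \<in> SU2 \<times> SU2. \<forall>v\<in>L2_0 M. e * sqnorm v \<le> displ (fst p) v \<or> e * sqnorm v \<le> displ (snd p) v}"

text \<open>Write g n as a times an element tending to the identity, so that strong continuity at
  the identity suffices. The factor 2 is the loss in \<open>displ_mult\<close>.\<close>

lemma displ_limit_less:
  assumes v: "v \<in> L2" and g: "\<And>n. g n \<in> SU2" "a \<in> SU2" and lim: "g \<longlonglongrightarrow> a"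
    and less: "2 * displ a v < c"
  shows "eventually (\<lambda>n. displ (g n) v < c) sequentially"
proof -
  have k: "cadj a ** g n \<in> SU2" for n using g by simp
  have "isCont (\<lambda>k. cadj a ** k) a"
    using continuous_on_matrix_mult[OF continuous_on_const continuous_on_id, of UNIV "cadj a"]
    by (simp add: continuous_on_eq_continuous_at)
  from isCont_tendsto_compose[OF this lim] have "(\<lambda>n. cadj a ** g n) \<longlonglongrightarrow> mat 1"
    using g(2) by simp
  from displ_tendsto_0[OF v k this] have "(\<lambda>n. 2 * displ a v + 2 * displ (cadj a ** g n) v) \<longlonglongrightarrow> 2 * displ a v + 2 * 0"
    by (intro tendsto_intros)
  from order_tendstoD(2)[OF this, of c] have "eventually (\<lambda>n. 2 * displ a v + 2 * displ (cadj a ** g n) v < c) sequentially"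
    using less by simp
  then show ?thesis
  proof eventually_elim
    case (elim n)
    have "displ (a ** (cadj a ** g n)) v \<le> 2 * displ a v + 2 * displ (cadj a ** g n) v"
      by (rule displ_mult[OF g(2) k v])
    then show ?case using elim g(2) by (simp add: SU2_cancel)
  qed
qed

text \<open>A vector violating the bound e / 4 at a limit pair would violate the bound e at nearby
  pairs of the sequence, even after the factor 2 of \<open>displ_limit_less\<close>.\<close>

lemma closure_gap_pairs:
  assumes e: "e > 0"
  shows "closure (gap_pairs e) \<inter> (SU2 \<times> SU2) \<subseteq> gap_pairs (e / 4)"
proof
  fix p assume p: "p \<in> closure (gap_pairs e) \<inter> (SU2 \<times> SU2)"
  then obtain q where q: "\<And>n. q n \<in> gap_pairs e" "q \<longlonglongrightarrow> p" by (auto simp: closure_sequential)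
  have q1: "fst (q n) \<in> SU2" "snd (q n) \<in> SU2" for n using q(1)[of n] by (auto simp: gap_pairs_def)
  have p1: "fst p \<in> SU2" "snd p \<in> SU2" using p by auto
  have "e / 4 * sqnorm v \<le> displ (fst p) v \<or> e / 4 * sqnorm v \<le> displ (snd p) v" if v: "v \<in> L2_0 M" for v
  proof (rule ccontr)
    assume "\<not> ?thesis"
    then have l: "2 * displ (fst p) v < e * sqnorm v" "2 * displ (snd p) v < e * sqnorm v"
      using displ_nonneg[of "fst p" v] displ_nonneg[of "snd p" v] by auto
    have "eventually (\<lambda>n. displ (fst (q n)) v < e * sqnorm v) sequentially"
      by (rule displ_limit_less[OF L2_0_subset_L2[OF v] q1(1) p1(1) tendsto_fst[OF q(2)] l(1)])
    moreover have "eventually (\<lambda>n. displ (snd (q n)) v < e * sqnorm v) sequentially"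
      by (rule displ_limit_less[OF L2_0_subset_L2[OF v] q1(2) p1(2) tendsto_snd[OF q(2)] l(2)])
    ultimately have "eventually (\<lambda>n. False) sequentially"
    proof eventually_elim
      case (elim n)
      have "e * sqnorm v \<le> displ (fst (q n)) v \<or> e * sqnorm v \<le> displ (snd (q n)) v"
        using q(1)[of n] v by (simp add: gap_pairs_def)
      with elim show False by simp
    qed
    then show False by simp
  qed
  then show "p \<in> gap_pairs (e / 4)" using p by (auto simp: gap_pairs_def)
qed

definition SG_pairs :: "((complex^2^2) \<times> (complex^2^2)) set" where
  "SG_pairs = {(a, b). a \<in> SU2 \<and> b \<in> SU2 \<and> spectral_gap M [a, b]}"

text \<open>Taking closures only weakens the gap constant and keeps it positive, so the union over
  all constants is unchanged. It is thereby exhibited as a countable union of closed sets.\<close>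

lemma SG_pairs_eq: "SG_pairs = (\<Union>m. closure (gap_pairs (inverse (real (Suc m)))) \<inter> (SU2 \<times> SU2))"
proof (intro equalityI subsetI)
  fix p assume "p \<in> SG_pairs"
  then obtain e where p: "p \<in> SU2 \<times> SU2" and e: "e > 0"
    "\<And>v. v \<in> L2_0 M \<Longrightarrow> e * sqnorm v \<le> displ (fst p) v \<or> e * sqnorm v \<le> displ (snd p) v"
    by (auto simp: SG_pairs_def spectral_gap_pair_iff)
  obtain m where m: "inverse (real (Suc m)) < e" using reals_Archimedean[OF e(1)] by blast
  have "inverse (real (Suc m)) * sqnorm v \<le> e * sqnorm v" for v
    using m sqnorm_nonneg[of v] by (intro mult_right_mono) auto
  then have "p \<in> gap_pairs (inverse (real (Suc m)))"
    using p e(2) unfolding gap_pairs_def by (blast intro: order_trans)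
  then show "p \<in> (\<Union>m. closure (gap_pairs (inverse (real (Suc m)))) \<inter> (SU2 \<times> SU2))"
    using closure_subset p by blast
next
  fix p assume "p \<in> (\<Union>m. closure (gap_pairs (inverse (real (Suc m)))) \<inter> (SU2 \<times> SU2))"
  then obtain m where "p \<in> gap_pairs (inverse (real (Suc m)) / 4)"
    using closure_gap_pairs[OF inverse_positive_iff_positive[THEN iffD2, OF of_nat_0_less_iff[THEN iffD2, OF zero_less_Suc]]]
    by blast
  then show "p \<in> SG_pairs"
    by (cases p) (auto simp: gap_pairs_def SG_pairs_def spectral_gap_pair_iff intro!: exI[of _ "inverse (real (Suc m)) / 4"])
qed

lemma SG_pairs_borel: "SG_pairs \<in> sets borel"
proof -
  have "closed (closure (gap_pairs e) \<inter> (SU2 \<times> SU2))" for e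
    by (intro closed_Int closed_Times closed_SU2 closed_closure)
  then show ?thesis unfolding SG_pairs_eq by (intro sets.countable_UN) (auto intro: borel_closed)
qed

end

section \<open>The zero-one law\<close>

text \<open>After normalisation the diagonal entry of b has modulus at most 1, and 1 minus its
  squared modulus is the Gram value divided by 1 - x^2.\<close>

lemma gram_nonneg:
  assumes a: "a \<in> SU2" and b: "b \<in> SU2" and x: "(qre a)\<^sup>2 < 1"
  shows "0 \<le> gram (qre a) (qre b) (qre (a ** b))"
proof -
  define c where "c = rel_coord (qre a) (qre b) (qre (a ** b))"
  obtain g where g: "g \<in> SU2" "g ** b ** cadj g = rel_form (qre a) (qre b) (qre (a ** b))"
    using SU2_pair_normal_form[OF a b x] by metis
  have "rel_form (qre a) (qre b) (qre (a ** b)) \<in> SU2"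
    unfolding g(2)[symmetric] using g(1) b by simp
  then have "(cmod c)\<^sup>2 \<le> 1"
    unfolding rel_form_def quat_in_SU2_iff c_def[symmetric]
    using zero_le_power2[of "cmod (complex_of_real (sqrt (1 - (cmod c)\<^sup>2)))"] by linarith
  then have "0 \<le> gram (qre a) (qre b) (qre (a ** b)) / (1 - (qre a)\<^sup>2)"
    unfolding rel_coord_norm[OF x, symmetric] c_def by simp
  then show ?thesis using x by (simp add: zero_le_divide_iff)
qed

lemma diag_form_measurable: "diag_form \<in> borel_measurable borel"
proof -
  have [measurable]: "(\<lambda>x. Complex x (sqrt (1 - x\<^sup>2))) \<in> borel_measurable borel"
    unfolding Complex_eq by measurable
  show ?thesis unfolding diag_form_def by measurable
qed

lemma rel_form_measurable:
  "(\<lambda>p. rel_form (fst p) (fst (snd p)) (snd (snd p))) \<in> borel_measurable (borel \<Otimes>\<^sub>M borel \<Otimes>\<^sub>M borel)"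
proof -
  have [measurable]: "(\<lambda>p. rel_coord (fst p) (fst (snd p)) (snd (snd p))) \<in> borel_measurable (borel \<Otimes>\<^sub>M borel \<Otimes>\<^sub>M borel)"
    unfolding rel_coord_def Complex_eq by measurable
  show ?thesis unfolding rel_form_def by measurable
qed

context SU2_haar
begin

text \<open>Defined by pulling \<open>SG_pairs\<close> back along the normal forms, not as its image
  under the traces: preimages under Borel maps are Borel.\<close>

definition SG_coords :: "(real \<times> real \<times> real) set" where
  "SG_coords = {p. (fst p)\<^sup>2 < 1 \<and> 0 < gram (fst p) (fst (snd p)) (snd (snd p)) \<and>
    (diag_form (fst p), rel_form (fst p) (fst (snd p)) (snd (snd p))) \<in> SG_pairs}"

lemma SG_coords_borel: "SG_coords \<in> sets borel"
proof -
  have [measurable]: "SG_pairs \<in> sets (borel \<Otimes>\<^sub>M borel)" using SG_pairs_borel unfolding borel_prod .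
  note diag_form_measurable [measurable] rel_form_measurable [measurable]
  have "{p \<in> space (borel \<Otimes>\<^sub>M borel \<Otimes>\<^sub>M borel). (fst p)\<^sup>2 < 1 \<and> 0 < gram (fst p) (fst (snd p)) (snd (snd p)) \<and>
    (diag_form (fst p), rel_form (fst p) (fst (snd p)) (snd (snd p))) \<in> SG_pairs} \<in> sets (borel \<Otimes>\<^sub>M borel \<Otimes>\<^sub>M borel)"
    by measurable
  then show ?thesis unfolding SG_coords_def borel_prod by simp
qed

lemma SG_pairs_conj_iff:
  assumes "a \<in> SU2" "b \<in> SU2" "k \<in> SU2"
  shows "(k ** a ** cadj k, k ** b ** cadj k) \<in> SG_pairs \<longleftrightarrow> (a, b) \<in> SG_pairs"
proof
  assume "(a, b) \<in> SG_pairs"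
  then show "(k ** a ** cadj k, k ** b ** cadj k) \<in> SG_pairs"
    using assms spectral_gap_conj by (simp add: SG_pairs_def)
next
  have undo: "cadj k ** (k ** c ** cadj k) ** cadj (cadj k) = c" for c
    using assms(3) by (simp add: matrix_mul_assoc) (simp add: SU2_cancel)
  assume "(k ** a ** cadj k, k ** b ** cadj k) \<in> SG_pairs"
  then have "spectral_gap M [k ** a ** cadj k, k ** b ** cadj k]" by (simp add: SG_pairs_def)
  from spectral_gap_conj[OF _ _ cadj_SU2[OF assms(3)] this] show "(a, b) \<in> SG_pairs"
    unfolding undo using assms by (simp add: SG_pairs_def)
qed

lemma SG_pairs_iff_coords:
  assumes a: "a \<in> SU2" and b: "b \<in> SU2" and x: "(qre a)\<^sup>2 < 1"
    and gr: "0 < gram (qre a) (qre b) (qre (a ** b))"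
  shows "(a, b) \<in> SG_pairs \<longleftrightarrow> (qre a, qre b, qre (a ** b)) \<in> SG_coords"
proof -
  obtain g where g: "g \<in> SU2" "g ** a ** cadj g = diag_form (qre a)"
    "g ** b ** cadj g = rel_form (qre a) (qre b) (qre (a ** b))"
    using SU2_pair_normal_form[OF a b x] .
  show ?thesis
    using SG_pairs_conj_iff[OF a b g(1)] x gr unfolding g by (simp add: SG_coords_def)
qed

lemma coords_realized:
  assumes "x\<^sup>2 < 1" "0 < gram x y z"
  obtains a b where "a \<in> SU2" "b \<in> SU2" "qre a = x" "qre b = y" "qre (a ** b) = z"
    "(a, b) \<in> SG_pairs \<longleftrightarrow> (x, y, z) \<in> SG_coords"
proof (rule that)
  show s: "diag_form x \<in> SU2" "rel_form x y z \<in> SU2"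
    using assms by (auto intro!: diag_form_SU2 rel_form_SU2)
  show q: "qre (diag_form x) = x" "qre (rel_form x y z) = y" "qre (diag_form x ** rel_form x y z) = z"
    using qre_forms[OF assms(1)] by auto
  show "(diag_form x, rel_form x y z) \<in> SG_pairs \<longleftrightarrow> (x, y, z) \<in> SG_coords"
    using assms by (simp add: SG_coords_def)
qed

lemma gram_lt_1_right:
  assumes "x\<^sup>2 < 1" "0 < gram x y z"
  shows "y\<^sup>2 < 1"
proof -
  have "0 < (1 - x\<^sup>2) * (1 - y\<^sup>2)" using assms(2) zero_le_power2[of "z - x * y"] unfolding gram_eq by linarith
  then show ?thesis using assms(1) by (simp add: zero_less_mult_iff)
qed

lemma SG_coords_null_or_conull:
  "(AE x in lborel. AE y in lborel. AE z in lborel. x\<^sup>2 < 1 \<longrightarrow> 0 < gram x y z \<longrightarrow> (x, y, z) \<notin> SG_coords) \<or>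
   (AE x in lborel. AE y in lborel. AE z in lborel. x\<^sup>2 < 1 \<longrightarrow> 0 < gram x y z \<longrightarrow> (x, y, z) \<in> SG_coords)"
proof (rule invariant_null_or_conull[OF SG_coords_borel])
  fix x y z :: real assume xyz: "x\<^sup>2 < 1" "0 < gram x y z"
  obtain a b where ab: "a \<in> SU2" "b \<in> SU2" and q: "qre a = x" "qre b = y" "qre (a ** b) = z"
    and iff: "(a, b) \<in> SG_pairs \<longleftrightarrow> (x, y, z) \<in> SG_coords"
    using coords_realized[OF xyz] .
  have q': "qre (a ** (a ** b)) = 2 * x * z - y" using qre_square_mult[OF ab] q by simp
  \<comment> \<open>The Gram value is unchanged, so the new coordinates still describe a
    noncommuting pair.\<close>
  have "gram x z (2 * x * z - y) = gram x y z"
    by (simp add: gram_def power2_eq_square algebra_simps)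
  then have "(a, a ** b) \<in> SG_pairs \<longleftrightarrow> (x, z, 2 * x * z - y) \<in> SG_coords"
    using SG_pairs_iff_coords[OF ab(1) mult_SU2[OF ab]] q q' xyz by simp
  moreover have "(a, a ** b) \<in> SG_pairs \<longleftrightarrow> (a, b) \<in> SG_pairs"
    using ab spectral_gap_mult_iff[OF ab] by (simp add: SG_pairs_def)
  ultimately show "(x, y, z) \<in> SG_coords \<longleftrightarrow> (x, z, 2 * x * z - y) \<in> SG_coords" using iff by simp
  have ba: "qre (b ** a) = z" using qre_mult_commute[OF ab] q by simp
  have "(b, a) \<in> SG_pairs \<longleftrightarrow> (y, x, z) \<in> SG_coords"
    using SG_pairs_iff_coords[OF ab(2,1)] q ba xyz gram_lt_1_right[OF xyz] by (simp add: gram_swap)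
  moreover have "(b, a) \<in> SG_pairs \<longleftrightarrow> (a, b) \<in> SG_pairs"
    using ab spectral_gap_swap by (auto simp: SG_pairs_def)
  ultimately show "(x, y, z) \<in> SG_coords \<longleftrightarrow> (y, x, z) \<in> SG_coords" using iff by simp
  assume x0: "x \<noteq> 0" and S: "(2 * x\<^sup>2 - 1, y, 2 * x * z - y) \<in> SG_coords"
  have "qre (a ** a) = 2 * x\<^sup>2 - 1" using qre_square[OF ab(1)] q by simp
  moreover have "qre (a ** a ** b) = 2 * x * z - y" using q' by (simp add: matrix_mul_assoc)
  \<comment> \<open>Membership in \<open>SG_coords\<close> includes these range conditions.\<close>
  moreover have "(2 * x\<^sup>2 - 1)\<^sup>2 < 1" "0 < gram (2 * x\<^sup>2 - 1) y (2 * x * z - y)"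
    using S by (auto simp: SG_coords_def)
  ultimately have "(a ** a, b) \<in> SG_pairs"
    using SG_pairs_iff_coords[of "a ** a" b] ab q S by simp
  then have "(a, b) \<in> SG_pairs" using spectral_gap_square[OF ab(1)] ab by (simp add: SG_pairs_def)
  then show "(x, y, z) \<in> SG_coords" using iff by simp
qed

lemma SG_pairs_AE_iff:
  assumes ae: "AE x in lborel. AE y in lborel. AE z in lborel. x\<^sup>2 < 1 \<longrightarrow> 0 < gram x y z \<longrightarrow>
      ((x, y, z) \<in> SG_coords \<longleftrightarrow> c)"
  shows "AE p in M \<Otimes>\<^sub>M M. p \<in> SG_pairs \<longleftrightarrow> c"
proof -
  interpret MM: pair_prob_space M M ..
  \<comment> \<open>Coordinates decide membership only where the Gram value is positive. It is never
    negative on actual pairs, so discarding the null set where it vanishes is enough.\<close>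
  let ?P = "\<lambda>x y z. gram x y z \<noteq> 0 \<and> (x\<^sup>2 < 1 \<longrightarrow> 0 < gram x y z \<longrightarrow> ((x, y, z) \<in> SG_coords \<longleftrightarrow> c))"
  have "AE x in lborel. AE y in lborel. AE z in lborel. x\<^sup>2 < 1 \<longrightarrow> ?P x y z"
    using ae
  proof (eventually_elim, goal_cases)
    case (1 x)
    then show ?case
    proof (eventually_elim, goal_cases)
      case (1 y)
      then show ?case
        using AE_gram_preimage[OF AE_lborel_singleton[of 0], of x y] by eventually_elim simp
    qed
  qed
  moreover have "{p. ?P (fst p) (fst (snd p)) (snd (snd p))} \<in> sets borel"
  proof -
    have [measurable]: "SG_coords \<in> sets (borel \<Otimes>\<^sub>M borel \<Otimes>\<^sub>M borel)"
      using SG_coords_borel unfolding borel_prod .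
    have "{p \<in> space (borel \<Otimes>\<^sub>M borel \<Otimes>\<^sub>M borel). ?P (fst p) (fst (snd p)) (snd (snd p))} \<in> sets (borel \<Otimes>\<^sub>M borel \<Otimes>\<^sub>M borel)"
      by measurable
    then show ?thesis unfolding borel_prod by simp
  qed
  ultimately have ae2: "AE a in M. AE b in M. (qre a)\<^sup>2 < 1 \<and> ?P (qre a) (qre b) (qre (a ** b))"
    by (intro haar_AE_coordinates[OF haar])
  have "AE a in M. AE b in M. (a, b) \<in> SG_pairs \<longleftrightarrow> c"
    using ae2 AE_space
  proof eventually_elim
    case (elim a)
    from elim(1) AE_space show ?case
    proof eventually_elim
      case (elim b)
      have ab: "a \<in> SU2" "b \<in> SU2" using elim \<open>a \<in> space M\<close> by (auto simp: space_M)
      have "0 < gram (qre a) (qre b) (qre (a ** b))"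
        using gram_nonneg[OF ab] elim by (simp add: less_le)
      then show ?case using SG_pairs_iff_coords[OF ab] elim by simp
    qed
  qed
  moreover have idm: "(\<lambda>x. x) \<in> M \<rightarrow>\<^sub>M borel" by (rule haar_borel(1)[OF haar]) simp
  have "(\<lambda>p. p) \<in> M \<Otimes>\<^sub>M M \<rightarrow>\<^sub>M borel \<Otimes>\<^sub>M borel"
    using measurable_Pair[OF measurable_compose[OF measurable_fst idm] measurable_compose[OF measurable_snd idm]] by simp
  then have [measurable]: "(\<lambda>p. p) \<in> M \<Otimes>\<^sub>M M \<rightarrow>\<^sub>M borel" unfolding borel_prod .
  note SG_pairs_borel [measurable]
  have "{p \<in> space (M \<Otimes>\<^sub>M M). p \<in> SG_pairs \<longleftrightarrow> c} \<in> sets (M \<Otimes>\<^sub>M M)"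
    by measurable
  ultimately show ?thesis
    by (intro MM.AE_pair_measure)
qed

end

theorem theorem1p1:
  fixes M :: "(complex^2^2) measure"
  assumes "is_haar_SU2 M"
  defines "SG2 \<equiv> {(a, b). a \<in> SU2 \<and> b \<in> SU2 \<and> spectral_gap M [a, b]}"
  shows "SG2 \<in> null_sets (completion (M \<Otimes>\<^sub>M M))
       \<or> (SU2 \<times> SU2) - SG2 \<in> null_sets (completion (M \<Otimes>\<^sub>M M))"
proof -
  interpret SU2_haar M by (rule SU2_haar.intro) (rule assms(1))
  have eq: "SG_pairs = SG2" by (simp add: SG_pairs_def assms(2))
  have sp: "space (M \<Otimes>\<^sub>M M) = SU2 \<times> SU2" by (simp add: space_pair_measure space_M)
  have sub: "SG2 \<subseteq> SU2 \<times> SU2" by (auto simp: assms(2))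
  have "(AE p in M \<Otimes>\<^sub>M M. p \<in> SG2 \<longleftrightarrow> False) \<or> (AE p in M \<Otimes>\<^sub>M M. p \<in> SG2 \<longleftrightarrow> True)"
    using SG_coords_null_or_conull
  proof (elim disjE)
    assume "AE x in lborel. AE y in lborel. AE z in lborel. x\<^sup>2 < 1 \<longrightarrow> 0 < gram x y z \<longrightarrow> (x, y, z) \<notin> SG_coords"
    then show ?thesis using SG_pairs_AE_iff[of False] unfolding eq by simp
  next
    assume "AE x in lborel. AE y in lborel. AE z in lborel. x\<^sup>2 < 1 \<longrightarrow> 0 < gram x y z \<longrightarrow> (x, y, z) \<in> SG_coords"
    then show ?thesis using SG_pairs_AE_iff[of True] unfolding eq by simp
  qed
  then show ?thesis
  proof
    assume "AE p in M \<Otimes>\<^sub>M M. p \<in> SG2 \<longleftrightarrow> False"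
    then have "{p \<in> space (completion (M \<Otimes>\<^sub>M M)). \<not> (p \<in> SG2 \<longleftrightarrow> False)} \<in> null_sets (completion (M \<Otimes>\<^sub>M M))"
      by (simp only: completion.AE_iff_null_sets[symmetric] AE_completion_iff)
    also have "{p \<in> space (completion (M \<Otimes>\<^sub>M M)). \<not> (p \<in> SG2 \<longleftrightarrow> False)} = SG2"
      using sub by (auto simp: sp)
    finally show ?thesis by (rule disjI1)
  next
    assume "AE p in M \<Otimes>\<^sub>M M. p \<in> SG2 \<longleftrightarrow> True"
    then have "{p \<in> space (completion (M \<Otimes>\<^sub>M M)). \<not> (p \<in> SG2 \<longleftrightarrow> True)} \<in> null_sets (completion (M \<Otimes>\<^sub>M M))"
      by (simp only: completion.AE_iff_null_sets[symmetric] AE_completion_iff)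
    also have "{p \<in> space (completion (M \<Otimes>\<^sub>M M)). \<not> (p \<in> SG2 \<longleftrightarrow> True)} = (SU2 \<times> SU2) - SG2"
      by (auto simp: sp)
    finally show ?thesis by (rule disjI2)
  qed
qed

end
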